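(* Let $\mathscr{D}$ be a dyadic lattice in $\mathbb{R}^n$ and let $\mathcal{S}\subset\mathscr{D}$ be an $\eta$-sparse family, $0<\eta<1$. Let $p>0$ and assume that the weight $w$ satisfies the $SC_p$ condition. Then for every locally integrable $f$ on $\mathbb{R}^n$, $$\|A_{\mathcal{S}}f\|_{L^{p,\infty}(w)}\le C\|Mf\|_{L^p(w)},$$ where $C>0$ does not depend on $f$.
   Context: A weight is a non-negative locally integrable function $w$ on $\mathbb{R}^n$; $w(E)=\int_E w$, $\|f\|_{L^p(w)}=\left(\int_{\mathbb{R}^n}|f|^pw\right)^{1/p}$ and $\|f\|_{L^{p,\infty}(w)}=\sup_{\alpha>0}\alpha\, w(\{x:|f(x)|>\alpha\})^{1/p}$. Cubes have sides parallel to the coordinate axes. The Hardy–Littlewood maximal function is $Mf(x)=\sup_{Q\ni x}\frac{1}{|Q|}\int_Q|f|$, the supremum being over all cubes $Q$ containing $x$. Definition ($SC_p$). Let $p>0$. A weight $w$ satisfies the $SC_p$ condition if there exist $C>0$ and $r>1$ such that for every family of pairwise disjoint cubes $\{Q_j\}$, $$\sum_j\left(\frac{1}{|Q_j|}\int_{Q_j}w^r\right)^{1/r}|Q_j|\le C\int_{\mathbb{R}^n}(M\chi_{\cup_jQ_j})^pw.$$ For a cube $Q_0$, $\mathcal{D}(Q_0)$ denotes the set of cubes obtained by repeated subdivision of $Q_0$ and each of its descendants into $2^n$ congruent subcubes (the $2^n$ subcubes of a cube are its children). A dyadic lattice $\mathscr{D}$ in $\mathbb{R}^n$ is any collection of cubes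 such that: (i) if $Q\in\mathscr{D}$, then each child of $Q$ is in $\mathscr{D}$; (ii) for every two cubes $Q',Q''\in\mathscr{D}$ there exists $Q\in\mathscr{D}$ such that $Q',Q''\in\mathcal{D}(Q)$; (iii) for every compact set $K\subset\mathbb{R}^n$ there exists a cube $Q\in\mathscr{D}$ containing $K$. A family $\mathcal{S}\subset\mathscr{D}$ is $\eta$-sparse, $0<\eta<1$, if for every $Q\in\mathcal{S}$, $$\Big|\bigcup_{Q'\in\mathcal{S}:\,Q'\subsetneq Q}Q'\Big|\le(1-\eta)|Q|.$$ The sparse operator is $A_{\mathcal{S}}f(x)=\sum_{Q\in\mathcal{S}}\left(\frac{1}{|Q|}\int_Q|f|\right)\chi_Q(x)$. *)

theory Defs
  imports "HOL-Analysis.Analysis"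
begin

section \<open>Weights and norms\<close>

definition locally_integrable :: "(real^'n \<Rightarrow> real) \<Rightarrow> bool" where
  "locally_integrable f \<longleftrightarrow> (\<forall>K. compact K \<longrightarrow> f absolutely_integrable_on K)"

definition weight :: "(real^'n \<Rightarrow> real) \<Rightarrow> bool" where
  "weight w \<longleftrightarrow> (\<forall>x. 0 \<le> w x) \<and> locally_integrable w"

definition wmeasure :: "(real^'n \<Rightarrow> real) \<Rightarrow> (real^'n) set \<Rightarrow> ennreal" where
  "wmeasure w E = (\<integral>\<^sup>+x\<in>E. ennreal (w x) \<partial>lebesgue)"

text \<open>The power \<open>x\<^sup>p\<close> on \<open>[0,\<infinity>]\<close>; it is only used for \<open>p > 0\<close>, where \<open>0\<^sup>p = 0\<close> and \<open>\<infinity>\<^sup>p = \<infinity>\<close>.\<close>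

definition ennpow :: "ennreal \<Rightarrow> real \<Rightarrow> ennreal" where
  "ennpow x p = (if x = \<infinity> then \<infinity> else ennreal (enn2real x powr p))"

text \<open>Maximal functions and sparse operators may be infinite at some points, so the (quasi-)norms
  are defined for functions with values in \<open>[0,\<infinity>]\<close>, for which \<open>\<bar>g\<bar> = g\<close>.\<close>

definition Lp_norm :: "real \<Rightarrow> (real^'n \<Rightarrow> real) \<Rightarrow> (real^'n \<Rightarrow> ennreal) \<Rightarrow> ennreal" where
  "Lp_norm p w g = ennpow (\<integral>\<^sup>+x. ennpow (g x) p * ennreal (w x) \<partial>lebesgue) (1 / p)"

definition weak_Lp_norm :: "real \<Rightarrow> (real^'n \<Rightarrow> real) \<Rightarrow> (real^'n \<Rightarrow> ennreal) \<Rightarrow> ennreal" where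
  "weak_Lp_norm p w g =
     (SUP \<alpha>\<in>{0<..}. ennreal \<alpha> * ennpow (wmeasure w {x. g x > ennreal \<alpha>}) (1 / p))"


section \<open>Cubes, averages and the maximal function\<close>

text \<open>Cubes are half-open, so that the children of a cube partition it. The interval
  \<open>{a..<b}\<close> cannot be used here: the strict order on vectors is not componentwise.\<close>

definition cube :: "real^'n \<Rightarrow> real \<Rightarrow> (real^'n) set" where
  "cube a l = {x. \<forall>i. a $ i \<le> x $ i \<and> x $ i < a $ i + l}"

definition cubes :: "(real^'n) set set" where
  "cubes = {cube a l | a l. 0 < l}"

definition avg :: "(real^'n) set \<Rightarrow> (real^'n \<Rightarrow> ennreal) \<Rightarrow> ennreal" where
  "avg Q g = (\<integral>\<^sup>+x\<in>Q. g x \<partial>lebesgue) / emeasure lebesgue Q"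

definition HL_maximal :: "(real^'n \<Rightarrow> real) \<Rightarrow> real^'n \<Rightarrow> ennreal" where
  "HL_maximal f x = (SUP Q\<in>{Q \<in> cubes. x \<in> Q}. avg Q (\<lambda>y. ennreal \<bar>f y\<bar>))"


section \<open>The condition \<open>SC\<^sub>p\<close>\<close>

text \<open>Cubes are nonempty, so a pairwise disjoint family of cubes is the same thing as a set of
  cubes that is \<^const>\<open>disjoint\<close>. Both sides of the inequality may be infinite.\<close>

definition SC :: "real \<Rightarrow> (real^'n \<Rightarrow> real) \<Rightarrow> bool" where
  "SC p w \<longleftrightarrow> (\<exists>C r. 0 < C \<and> 1 < r \<and>
     (\<forall>F. F \<subseteq> cubes \<and> disjoint F \<longrightarrow>
        (\<Sum>\<^sub>\<infinity>Q\<in>F. ennpow (avg Q (\<lambda>x. ennreal (w x powr r))) (1 / r) * emeasure lebesgue Q)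
          \<le> ennreal C * (\<integral>\<^sup>+x. ennpow (HL_maximal (indicator (\<Union>F)) x) p * ennreal (w x) \<partial>lebesgue)))"


section \<open>Dyadic lattices and sparse families\<close>

text \<open>A child is obtained by choosing in each coordinate the lower or the upper half of the side;
  \<open>e\<close> is the set of coordinates in which the upper half is chosen.\<close>

definition children :: "(real^'n) set \<Rightarrow> (real^'n) set set" where
  "children Q = {cube (\<chi> i. if i \<in> e then a $ i + l / 2 else a $ i) (l / 2) | a l e.
                   0 < l \<and> Q = cube a l}"

inductive_set dyadic_subcubes :: "(real^'n) set \<Rightarrow> (real^'n) set set"
  for Q0 :: "(real^'n) set" where
  self: "Q0 \<in> dyadic_subcubes Q0"
| child: "Q \<in> dyadic_subcubes Q0 \<Longrightarrow> Q' \<in> children Q \<Longrightarrow> Q' \<in> dyadic_subcubes Q0"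

definition dyadic_lattice :: "(real^'n) set set \<Rightarrow> bool" where
  "dyadic_lattice D \<longleftrightarrow>
     D \<subseteq> cubes \<and>
     (\<forall>Q\<in>D. children Q \<subseteq> D) \<and>
     (\<forall>Q'\<in>D. \<forall>Q''\<in>D. \<exists>Q\<in>D. Q' \<in> dyadic_subcubes Q \<and> Q'' \<in> dyadic_subcubes Q) \<and>
     (\<forall>K. compact K \<longrightarrow> (\<exists>Q\<in>D. K \<subseteq> Q))"

definition sparse_family :: "real \<Rightarrow> (real^'n) set set \<Rightarrow> bool" where
  "sparse_family \<eta> S \<longleftrightarrow>
     (\<forall>Q\<in>S. emeasure lebesgue (\<Union>{Q' \<in> S. Q' \<subset> Q}) \<le> ennreal (1 - \<eta>) * emeasure lebesgue Q)"

definition sparse_operator ::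
  "(real^'n) set set \<Rightarrow> (real^'n \<Rightarrow> real) \<Rightarrow> real^'n \<Rightarrow> ennreal" where
  "sparse_operator S f x = (\<Sum>\<^sub>\<infinity>Q\<in>S. avg Q (\<lambda>y. ennreal \<bar>f y\<bar>) * indicator Q x)"

end

theory Submission
  imports Defs
begin

text \<open>By exhaustion one may take \<open>S\<close> finite. Fix \<open>\<alpha>\<close>. The cubes on which the average of \<open>f\<close> exceeds
  \<open>\<alpha> / 2\<close> lie in \<open>{Mf > \<alpha> / 2}\<close>, which Chebyshev's inequality handles. The others are split into
  layers where the average is comparable to \<open>\<lambda> = \<alpha> / (2 * 4^m)\<close>; off the union of the former, the
  operator can exceed \<open>\<alpha>\<close> only where, for some \<open>m\<close>, more than \<open>2^m\<close> cubes of layer \<open>m\<close> overlap.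
  By sparseness this set occupies at most the fraction \<open>(1 - \<eta>)^(2^m)\<close> of each maximal cube of the
  layer, so the reverse-Hoelder-like quantity in \<open>SC\<^sub>p\<close> gives its \<open>w\<close>-measure a doubly exponentially
  small factor times the integral of \<open>(M \<chi>)^p w\<close>, where \<open>\<chi>\<close> is the indicator of the union of the
  maximal cubes. Finally \<open>M \<chi> \<le> C Mf / \<lambda>\<close>, and the loss \<open>4^(m p)\<close> is summable against the
  doubly exponential gain.\<close>

section \<open>Overlap of laminar families\<close>

definition laminar :: "'a set set \<Rightarrow> bool" where
  "laminar G \<longleftrightarrow> (\<forall>A\<in>G. \<forall>B\<in>G. A \<subseteq> B \<or> B \<subseteq> A \<or> A \<inter> B = {})"

definition maximal_sets :: "'a set set \<Rightarrow> 'a set set" where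
  "maximal_sets G = {R \<in> G. \<forall>Q\<in>G. R \<subseteq> Q \<longrightarrow> Q = R}"

text \<open>Since \<open>card\<close> is 0 on infinite sets, this is the superlevel set of the
  overlap count only when each point lies in finitely many members; it is applied to finite
  \<open>G\<close>.\<close>

definition level_set :: "nat \<Rightarrow> 'a set set \<Rightarrow> 'a set" where
  "level_set k G = {x. k < card {Q \<in> G. x \<in> Q}}"

lemma laminar_subset: "laminar G \<Longrightarrow> H \<subseteq> G \<Longrightarrow> laminar H"
  unfolding laminar_def by blast

lemma maximal_sets_subset: "maximal_sets G \<subseteq> G"
  unfolding maximal_sets_def by blast

lemma disjoint_maximal_sets:
  assumes "laminar G"
  shows "disjoint (maximal_sets G)"
proof (rule disjointI)
  fix A B assume "A \<in> maximal_sets G" "B \<in> maximal_sets G" "A \<noteq> B"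
  then have "A \<in> G" "B \<in> G" "\<not> A \<subseteq> B" "\<not> B \<subseteq> A"
    by (auto simp: maximal_sets_def)
  then show "A \<inter> B = {}" using assms by (meson laminar_def)
qed

lemma Union_maximal_sets:
  assumes "finite G"
  shows "\<Union>(maximal_sets G) = \<Union>G"
proof
  show "\<Union>G \<subseteq> \<Union>(maximal_sets G)"
  proof
    fix x assume "x \<in> \<Union>G"
    then obtain Q where Q: "Q \<in> G" "x \<in> Q" by blast
    obtain R where "R \<in> G" "Q \<subseteq> R" "\<forall>B\<in>G. R \<subseteq> B \<longrightarrow> R = B"
      using finite_has_maximal2[OF assms Q(1)] by blast
    then show "x \<in> \<Union>(maximal_sets G)"
      using Q unfolding maximal_sets_def by blast
  qed
qed (auto simp: maximal_sets_def)

lemma level_set_subset_Union: "level_set k G \<subseteq> \<Union>G"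
proof
  fix x assume "x \<in> level_set k G"
  then have "card {Q \<in> G. x \<in> Q} \<noteq> 0" by (auto simp: level_set_def)
  then have "{Q \<in> G. x \<in> Q} \<noteq> {}" by (intro notI) simp
  then show "x \<in> \<Union>G" by blast
qed

lemma sets_level_set:
  assumes "finite G" "G \<subseteq> sets M" "space M = UNIV"
  shows "level_set k G \<in> sets M"
proof -
  have "(\<lambda>x. \<Sum>Q\<in>G. indicator Q x :: real) \<in> borel_measurable M"
    using assms by (intro borel_measurable_sum borel_measurable_indicator) auto
  then have "{x \<in> space M. real k < (\<Sum>Q\<in>G. indicator Q x)} \<in> sets M"
    by measurable
  moreover have "(\<Sum>Q\<in>G. indicator Q x :: real) = real (card {Q \<in> G. x \<in> Q})" for x
    using assms(1) by (simp add: indicator_def sum.If_cases Int_def)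
  ultimately show ?thesis
    using assms(3) by (simp add: level_set_def)
qed

text \<open>Inside a maximal set \<open>R\<close>, the points covered more than \<open>k + 1\<close> times are covered more than
  \<open>k\<close> times by the proper subsets of \<open>R\<close>, and each generation costs a factor \<open>c\<close>.\<close>

lemma emeasure_level_set_le:
  fixes c :: ennreal
  assumes "finite G" "G \<subseteq> sets M" "space M = UNIV" "laminar G"
    and "\<And>Q. Q \<in> G \<Longrightarrow> emeasure M (\<Union>{Q' \<in> G. Q' \<subset> Q}) \<le> c * emeasure M Q"
    and "R \<in> maximal_sets G"
  shows "emeasure M (R \<inter> level_set k G) \<le> c ^ k * emeasure M R"
  using assms
proof (induction k arbitrary: G R)
  case 0
  then have "R \<in> sets M" using maximal_sets_subset by blast
  then show ?case by (simp add: emeasure_mono)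
next
  case (Suc k)
  define H where "H = {Q \<in> G. Q \<subset> R}"
  have RG: "R \<in> G" and HG: "H \<subseteq> G" and fH: "finite H"
    using Suc.prems(1,6) by (auto simp: H_def maximal_sets_def)
  have lH: "laminar H" using laminar_subset Suc.prems(4) HG .
  have mH: "maximal_sets H \<subseteq> sets M"
    using HG Suc.prems(2) maximal_sets_subset[of H] by order
  have fmH: "finite (maximal_sets H)"
    using finite_subset[OF maximal_sets_subset fH] .
  have spH: "emeasure M (\<Union>{Q' \<in> H. Q' \<subset> Q}) \<le> c * emeasure M Q" if "Q \<in> H" for Q
  proof -
    \<comment> \<open>Everything below a \<open>Q\<close> that lies properly inside \<open>R\<close>
      is itself properly inside \<open>R\<close>, so \<open>H\<close> keeps all of it and the
      hypothesis carries over with the same \<open>c\<close>.\<close>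
    have "{Q' \<in> H. Q' \<subset> Q} = {Q' \<in> G. Q' \<subset> Q}" using that by (auto simp: H_def)
    then show ?thesis using Suc.prems(5)[of Q] that HG by auto
  qed
  have lev: "level_set k H \<in> sets M"
    using sets_level_set[OF fH _ Suc.prems(3)] HG Suc.prems(2) by blast
  have "R \<inter> level_set (Suc k) G \<subseteq> (\<Union>Q\<in>maximal_sets H. Q \<inter> level_set k H)"
  proof
    fix x assume x: "x \<in> R \<inter> level_set (Suc k) G"
    \<comment> \<open>Laminarity makes every member through a point of \<open>R\<close> comparable
      with \<open>R\<close>, and maximality excludes a larger one. Hence removing \<open>R\<close>
      lowers the count by exactly one.\<close>
    have "Q = R \<or> Q \<in> H" if "Q \<in> G" "x \<in> Q" for Q
    proof -
      have "Q \<subseteq> R \<or> R \<subseteq> Q"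
        using Suc.prems(4) RG that x unfolding laminar_def by blast
      then show ?thesis
        using that Suc.prems(6) unfolding H_def maximal_sets_def by blast
    qed
    then have "{Q \<in> G. x \<in> Q} = insert R {Q \<in> H. x \<in> Q}"
      using x RG HG by blast
    moreover have "R \<notin> {Q \<in> H. x \<in> Q}" by (simp add: H_def)
    ultimately have "card {Q \<in> G. x \<in> Q} = Suc (card {Q \<in> H. x \<in> Q})"
      using fH by simp
    then have lev_x: "x \<in> level_set k H" using x by (simp add: level_set_def)
    then have "x \<in> \<Union>(maximal_sets H)"
      using level_set_subset_Union[of k H] by (auto simp: Union_maximal_sets[OF fH])
    with lev_x show "x \<in> (\<Union>Q\<in>maximal_sets H. Q \<inter> level_set k H)" by simp
  qed
  then have "emeasure M (R \<inter> level_set (Suc k) G)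
      \<le> emeasure M (\<Union>Q\<in>maximal_sets H. Q \<inter> level_set k H)"
    using fmH mH lev by (intro emeasure_mono sets.finite_UN) auto
  also have "\<dots> \<le> (\<Sum>Q\<in>maximal_sets H. emeasure M (Q \<inter> level_set k H))"
    using fmH mH lev by (intro emeasure_subadditive_finite) auto
  also have "\<dots> \<le> (\<Sum>Q\<in>maximal_sets H. c ^ k * emeasure M Q)"
    using HG Suc.prems(2) by (intro sum_mono Suc.IH[OF fH _ Suc.prems(3) lH spH]) auto
  also have "\<dots> = c ^ k * (\<Sum>Q\<in>maximal_sets H. emeasure M Q)"
    by (simp add: sum_distrib_left)
  \<comment> \<open>Disjointness turns the sum back into the measure of a union, which the
    hypothesis at \<open>R\<close> bounds; this is where the extra factor \<open>c\<close> is
    gained.\<close>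
  also have "(\<Sum>Q\<in>maximal_sets H. emeasure M Q) = emeasure M (\<Union>Q\<in>maximal_sets H. Q)"
    using fmH mH disjoint_maximal_sets[OF lH]
    by (intro sum_emeasure) (auto simp: disjoint_family_on_def disjoint_def)
  also have "(\<Union>Q\<in>maximal_sets H. Q) = \<Union>{Q' \<in> G. Q' \<subset> R}"
    using Union_maximal_sets[OF fH] by (simp add: H_def)
  also have "c ^ k * emeasure M (\<Union>{Q' \<in> G. Q' \<subset> R}) \<le> c ^ k * (c * emeasure M R)"
    using Suc.prems(5)[OF RG] by (intro mult_left_mono) auto
  finally show ?case by (simp add: mult_ac)
qed

section \<open>Cubes and dyadic lattices\<close>

lemma cube_nonempty: "0 < l \<Longrightarrow> a \<in> cube a l"
  by (simp add: cube_def)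

text \<open>Makes the representation of a cube unique, so that the corner and side quantified inside
  \<open>children\<close> can be identified with given ones.\<close>

lemma cube_eq_iff:
  assumes "0 < l" "0 < l'"
  shows "cube a l = cube a' l' \<longleftrightarrow> a = a' \<and> l = l'"
proof
  assume eq: "cube a l = cube a' l'"
  have "a \<in> cube a' l'" "a' \<in> cube a l"
    using cube_nonempty[OF assms(1), of a] cube_nonempty[OF assms(2), of a'] eq by simp_all
  then have "a $ i = a' $ i" for i
    by (simp add: cube_def order_antisym)
  then have a: "a = a'" by (simp add: vec_eq_iff)
  \<comment> \<open>The offset is the mean of the two sides: if they differ, it is below the larger
    and above the smaller, so \<open>x\<close> lies in just one of the cubes.\<close>
  define x where "x = (\<chi> i. a $ i + (l + l') / 2)"
  have "x \<in> cube a l \<longleftrightarrow> l' < l" "x \<in> cube a' l' \<longleftrightarrow> l < l'"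
    using assms by (simp_all add: x_def cube_def a)
  with eq have "l = l'" by (cases l l' rule: linorder_cases) simp_all
  with a show "a = a' \<and> l = l'" by simp
qed simp

lemma sets_cube [measurable]: "cube a l \<in> sets borel"
  unfolding cube_def by measurable

lemma emeasure_lborel_cube:
  fixes a :: "real^'n"
  assumes "0 < l"
  shows "emeasure lborel (cube a l) = ennreal (l ^ CARD('n))"
proof -
  define b where "b = (\<chi> i. a $ i + l)"
  have *: "a \<bullet> v \<le> b \<bullet> v" if "v \<in> Basis" for v
    using that assms by (auto simp: b_def Basis_vec_def inner_axis)
  have "(\<Prod>v\<in>Basis. (b - a) \<bullet> v) = (\<Prod>v\<in>(Basis :: (real^'n) set). l)"
    by (intro prod.cong) (auto simp: b_def Basis_vec_def inner_axis)
  then have "emeasure lborel (cbox a b) = ennreal (l ^ CARD('n))"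
      "emeasure lborel (box a b) = ennreal (l ^ CARD('n))"
    using * by (simp_all add: prod_constant)
  moreover have "box a b \<subseteq> cube a l" and "cube a l \<subseteq> cbox a b"
    by (simp_all add: subset_iff cube_def b_def mem_box_cart less_imp_le)
  ultimately show ?thesis
    using emeasure_mono[of "box a b" "cube a l" lborel] emeasure_mono[of "cube a l" "cbox a b" lborel]
    by simp
qed

lemma cube_in_cubes: "0 < l \<Longrightarrow> cube a l \<in> cubes"
  unfolding cubes_def by blast

lemma cubesE:
  assumes "Q \<in> cubes"
  obtains a l where "Q = cube a l" "0 < l"
  using assms unfolding cubes_def by blast

lemma sets_cubes: "Q \<in> cubes \<Longrightarrow> Q \<in> sets lebesgue"
  using sets_cube by (auto simp: cubes_def)

text \<open>Generation \<open>k\<close> of the subdivision of \<open>cube a l\<close>, continued to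
  a grid of the whole space: \<open>m\<close> runs over all integer vectors, so that positions obey
  plain integer arithmetic.\<close>

definition grid_cube :: "real^'n \<Rightarrow> real \<Rightarrow> nat \<Rightarrow> int^'n \<Rightarrow> (real^'n) set" where
  "grid_cube a l k m = cube (\<chi> i. a $ i + l / 2 ^ k * of_int (m $ i)) (l / 2 ^ k)"

lemma dyadic_subcubes_grid:
  assumes "0 < l" "Q \<in> dyadic_subcubes (cube a l)"
  shows "\<exists>k m. Q = grid_cube a l k m"
  using assms(2)
proof induction
  case self
  have "cube a l = grid_cube a l 0 0" by (simp add: grid_cube_def)
  then show ?case by blast
next
  case (child Q Q')
  then obtain k m where Q: "Q = grid_cube a l k m" by blast
  obtain b s e where "0 < s" "Q = cube b s"
    and Q': "Q' = cube (\<chi> i. if i \<in> e then b $ i + s / 2 else b $ i) (s / 2)"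
    using child.hyps(2) unfolding children_def by blast
  then have "b = (\<chi> i. a $ i + l / 2 ^ k * of_int (m $ i))" "s = l / 2 ^ k"
    using Q assms(1) by (auto simp: cube_eq_iff grid_cube_def)
  moreover from this have "l / 2 ^ Suc k = s / 2" by simp
  \<comment> \<open>Halving the mesh doubles the integer position; choosing the upper half in a
    coordinate adds one.\<close>
  ultimately have "Q' = grid_cube a l (Suc k) (\<chi> i. 2 * m $ i + (if i \<in> e then 1 else 0))"
    unfolding Q' grid_cube_def
    by (auto intro!: arg_cong2[where f = cube] simp: vec_eq_iff algebra_simps simp del: power_Suc)
  then show ?case by blast
qed

text \<open>In units of the finer side \<open>s\<close> both cubes have integer positions, and the
  coarse side is the integer \<open>d\<close>. A common point gives strict inequalities between
  integers; rounding them by one yields containment in each coordinate.\<close>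

lemma grid_cube_nested:
  assumes "0 < l" "j \<le> k" "grid_cube a l j m \<inter> grid_cube a l k m' \<noteq> {}"
  shows "grid_cube a l k m' \<subseteq> grid_cube a l j m"
proof -
  define s where "s = l / 2 ^ k"
  have s: "0 < s" using assms(1) by (simp add: s_def)
  define d :: int where "d = 2 ^ (k - j)"
  have lj: "l / 2 ^ j = s * of_int d"
    using assms(2) by (simp add: s_def d_def field_simps flip: power_add)
  obtain x where "x \<in> grid_cube a l j m" "x \<in> grid_cube a l k m'"
    using assms(3) by blast
  then have x: "a $ i + s * of_int d * of_int (m $ i) \<le> x $ i"
      "x $ i < a $ i + s * of_int d * of_int (m $ i) + s * of_int d"
      "a $ i + s * of_int (m' $ i) \<le> x $ i" "x $ i < a $ i + s * of_int (m' $ i) + s" for i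
    by (simp_all add: grid_cube_def cube_def lj flip: s_def)
  have lo: "d * m $ i \<le> m' $ i" and hi: "m' $ i + 1 \<le> d * m $ i + d" for i
  proof -
    have "s * of_int (d * m $ i) < s * of_int (m' $ i + 1)"
      using x(1,4)[of i] by (simp add: algebra_simps)
    then have "d * m $ i < m' $ i + 1"
      using s by (simp only: mult_less_cancel_left_pos of_int_less_iff)
    then show "d * m $ i \<le> m' $ i" by simp
    have "s * of_int (m' $ i) < s * of_int (d * m $ i + d)"
      using x(2,3)[of i] by (simp add: algebra_simps)
    then have "m' $ i < d * m $ i + d"
      using s by (simp only: mult_less_cancel_left_pos of_int_less_iff)
    then show "m' $ i + 1 \<le> d * m $ i + d" by simp
  qed
  have lo': "s * of_int d * of_int (m $ i) \<le> s * of_int (m' $ i)" for i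
    using lo[of i] s by (simp add: mult.assoc flip: of_int_mult)
  have hi': "s * of_int (m' $ i) + s \<le> s * of_int d * of_int (m $ i) + s * of_int d" for i
  proof -
    have "s * of_int (m' $ i + 1) \<le> s * of_int (d * m $ i + d)"
      using hi[of i] s by (simp only: mult_le_cancel_left_pos of_int_le_iff)
    then show ?thesis by (simp add: algebra_simps)
  qed
  show ?thesis
  proof
    fix y assume "y \<in> grid_cube a l k m'"
    then have y: "a $ i + s * of_int (m' $ i) \<le> y $ i" "y $ i < a $ i + s * of_int (m' $ i) + s" for i
      by (simp_all add: grid_cube_def cube_def flip: s_def)
    have "a $ i + s * of_int d * of_int (m $ i) \<le> y $ i"
      "y $ i < a $ i + s * of_int d * of_int (m $ i) + s * of_int d" for i
      using y(1,2)[of i] lo'[of i] hi'[of i] by linarith+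
    then show "y \<in> grid_cube a l j m" by (simp add: grid_cube_def cube_def lj)
  qed
qed

lemma dyadic_lattice_cubes: "dyadic_lattice D \<Longrightarrow> D \<subseteq> cubes"
  by (simp add: dyadic_lattice_def)

lemma dyadic_lattice_common_grid:
  assumes "dyadic_lattice D" "Q \<in> D" "Q' \<in> D"
  obtains a l k m k' m' where "0 < l" "Q = grid_cube a l k m" "Q' = grid_cube a l k' m'"
proof -
  obtain R where R: "R \<in> D" "Q \<in> dyadic_subcubes R" "Q' \<in> dyadic_subcubes R"
    using assms unfolding dyadic_lattice_def by blast
  obtain a l where "0 < l" "R = cube a l"
    using dyadic_lattice_cubes[OF assms(1)] R(1) unfolding cubes_def by blast
  then obtain k m k' m' where "Q = grid_cube a l k m" "Q' = grid_cube a l k' m'"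
    using dyadic_subcubes_grid[of l Q a] dyadic_subcubes_grid[of l Q' a] R(2,3) by metis
  with \<open>0 < l\<close> show thesis by (rule that)
qed

lemma laminar_dyadic_lattice:
  assumes "dyadic_lattice D"
  shows "laminar D"
  unfolding laminar_def
proof (intro ballI)
  fix Q Q' assume "Q \<in> D" "Q' \<in> D"
  then obtain a l k m k' m' where *: "0 < l" "Q = grid_cube a l k m" "Q' = grid_cube a l k' m'"
    by (metis dyadic_lattice_common_grid[OF assms])
  show "Q \<subseteq> Q' \<or> Q' \<subseteq> Q \<or> Q \<inter> Q' = {}"
  proof (cases "k \<le> k'")
    case True
    then show ?thesis using grid_cube_nested[OF *(1) True, of a m m'] *(2,3) by auto
  next
    case False
    then have "k' \<le> k" by simp
    then show ?thesis using grid_cube_nested[OF *(1) \<open>k' \<le> k\<close>, of a m' m] *(2,3) by auto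
  qed
qed

text \<open>Relative to a fixed cube of the lattice, every other one is determined by the positions of
  the two cubes in the grid of a common ancestor, which are integers.\<close>

lemma countable_dyadic_lattice:
  fixes D :: "(real^'n) set set"
  assumes "dyadic_lattice D"
  shows "countable D"
proof -
  obtain Q0 where Q0: "Q0 \<in> D"
    \<comment> \<open>The covering condition, applied to the empty compact set, shows that the
      lattice is nonempty.\<close>
    using assms unfolding dyadic_lattice_def by (metis compact_empty)
  obtain b s where b: "0 < s" "Q0 = cube b s"
    using dyadic_lattice_cubes[OF assms(1)] Q0 unfolding cubes_def by blast
  \<comment> \<open>If \<open>Q0\<close> has generation \<open>j\<close> and position
    \<open>m0\<close> in the common grid, then the ancestor has side \<open>s * 2 ^ j\<close> and
    corner \<open>b - s * m0\<close>, so only integer data remain free.\<close>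
  define h :: "nat \<times> nat \<times> (int^'n) \<times> (int^'n) \<Rightarrow> (real^'n) set" where
    "h = (\<lambda>(j, k, m0, m). grid_cube (\<chi> i. b $ i - s * of_int (m0 $ i)) (s * 2 ^ j) k m)"
  have "D \<subseteq> range h"
  proof
    fix Q assume "Q \<in> D"
    then obtain a l k m j m0 where *: "0 < l" "Q = grid_cube a l k m" "Q0 = grid_cube a l j m0"
      using dyadic_lattice_common_grid[OF assms _ Q0] by metis
    then have bs: "b = (\<chi> i. a $ i + l / 2 ^ j * of_int (m0 $ i))" "s = l / 2 ^ j"
      using b by (auto simp: cube_eq_iff grid_cube_def)
    then have "a = (\<chi> i. b $ i - s * of_int (m0 $ i))" "l = s * 2 ^ j"
      by (simp_all add: vec_eq_iff)
    then have "Q = h (j, k, m0, m)" by (simp add: * h_def)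
    then show "Q \<in> range h" by blast
  qed
  then show ?thesis by (rule countable_subset) simp
qed

section \<open>Maximal function of a union of cubes\<close>

text \<open>The truncations to balls of radius \<open>k\<close> are measurable and, at each point,
  eventually equal to \<open>f\<close>.\<close>

lemma borel_measurable_locally_integrable:
  assumes "locally_integrable f"
  shows "f \<in> borel_measurable lebesgue"
proof (rule borel_measurable_LIMSEQ_real)
  show "(\<lambda>x. indicator (cball 0 (real k)) x *\<^sub>R f x) \<in> borel_measurable lebesgue" for k
  proof -
    have "f absolutely_integrable_on cball 0 (real k)"
      using assms by (simp add: locally_integrable_def)
    then show ?thesis unfolding set_integrable_def by (rule borel_measurable_integrable)
  qed
  show "(\<lambda>k. indicator (cball 0 (real k)) x *\<^sub>R f x) \<longlonglongrightarrow> f x" for x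
  proof (rule tendsto_eventually)
    obtain N where "norm x \<le> real N" using real_arch_simple by blast
    then show "\<forall>\<^sub>F k in sequentially. indicator (cball 0 (real k)) x *\<^sub>R f x = f x"
      by (intro eventually_sequentiallyI[of N]) (auto simp: indicator_def)
  qed
qed

text \<open>For non-measurable \<open>f\<close> this is about lower integrals; this way the maximal function never has to
  be shown measurable.\<close>

lemma nn_integral_cmult_le:
  fixes f :: "'a \<Rightarrow> ennreal"
  assumes "0 < c"
  shows "(\<integral>\<^sup>+x. ennreal c * f x \<partial>M) \<le> ennreal c * (\<integral>\<^sup>+x. f x \<partial>M)"
  unfolding nn_integral_def[of M "\<lambda>x. ennreal c * f x"]
proof (rule SUP_least)
  fix g assume "g \<in> {g. simple_function M g \<and> g \<le> (\<lambda>x. ennreal c * f x)}"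
  then have g: "simple_function M g" "\<And>x. g x \<le> ennreal c * f x" by (auto simp: le_fun_def)
  have cc: "ennreal c * ennreal (1 / c) = 1"
    using assms by (simp flip: ennreal_mult)
  have "integral\<^sup>S M g = (\<integral>\<^sup>+x. g x \<partial>M)"
    using g(1) by (simp add: nn_integral_eq_simple_integral)
  \<comment> \<open>The constant is extracted only from the integral of the simple function
    \<open>g\<close>, which is measurable; \<open>g / c\<close> then lies below
    \<open>f\<close>.\<close>
  also have "\<dots> = (\<integral>\<^sup>+x. ennreal c * (ennreal (1 / c) * g x) \<partial>M)"
    by (simp only: cc mult_1_left flip: mult.assoc)
  also have "\<dots> = ennreal c * (\<integral>\<^sup>+x. ennreal (1 / c) * g x \<partial>M)"
    using borel_measurable_simple_function[OF g(1)] by (intro nn_integral_cmult) auto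
  also have "\<dots> \<le> ennreal c * (\<integral>\<^sup>+x. f x \<partial>M)"
  proof (intro mult_left_mono nn_integral_mono)
    fix x
    have "ennreal (1 / c) * g x \<le> ennreal (1 / c) * (ennreal c * f x)"
      using g(2) by (intro mult_left_mono) auto
    also have "\<dots> = (ennreal c * ennreal (1 / c)) * f x" by (simp only: mult_ac)
    also have "\<dots> = f x" unfolding cc by simp
    finally show "ennreal (1 / c) * g x \<le> f x" .
  qed simp
  finally show "integral\<^sup>S M g \<le> ennreal c * (\<integral>\<^sup>+x. f x \<partial>M)" .
qed

section \<open>Powers of extended non-negative reals and averages over cubes\<close>

lemma ennpow_ennreal: "0 \<le> x \<Longrightarrow> ennpow (ennreal x) p = ennreal (x powr p)"
  by (simp add: ennpow_def)

lemma ennpow_top: "ennpow top p = top"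
  by (simp add: ennpow_def)

lemma ennpow_mono:
  assumes "0 < p" "x \<le> y"
  shows "ennpow x p \<le> ennpow y p"
proof (cases y)
  case (real b)
  then obtain a where "x = ennreal a" "0 \<le> a" "a \<le> b"
    using assms(2) by (cases x) (auto simp: top_unique)
  with real assms(1) show ?thesis
    by (simp add: ennpow_ennreal powr_mono2)
qed (simp add: ennpow_top)

lemma ennpow_cmult:
  assumes "0 < c"
  shows "ennpow (ennreal c * x) p = ennreal (c powr p) * ennpow x p"
proof (cases x)
  case (real b)
  with assms show ?thesis
    by (simp add: ennpow_ennreal powr_mult flip: ennreal_mult)
next
  case top
  with assms show ?thesis by (simp add: ennpow_top ennreal_mult_top)
qed

lemma emeasure_cube_pos:
  assumes "0 < l"
  shows "emeasure lebesgue (cube a l) \<noteq> 0" "emeasure lebesgue (cube a l) \<noteq> top"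
  using assms by (simp_all add: emeasure_lborel_cube)

lemma avg_mult_emeasure:
  assumes "0 < l"
  shows "avg (cube a l) g * emeasure lebesgue (cube a l) = (\<integral>\<^sup>+x\<in>cube a l. g x \<partial>lebesgue)"
  unfolding avg_def using ennreal_divide_self[OF emeasure_cube_pos(1)[OF assms, of a]]
    emeasure_cube_pos(2)[OF assms, of a]
  by (simp only: ennreal_divide_times less_top mult_1_right)

lemma avg_le_HL_maximal:
  "Q \<in> cubes \<Longrightarrow> x \<in> Q \<Longrightarrow> avg Q (\<lambda>y. ennreal \<bar>f y\<bar>) \<le> HL_maximal f x"
  unfolding HL_maximal_def by (rule SUP_upper) simp

text \<open>The right-hand side is the concentric triple of \<open>cube b s\<close>: a cube of side
  at most \<open>s\<close> that meets \<open>cube b s\<close> reaches less than \<open>s\<close>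
  beyond it in each coordinate. With both cubes equal, it shows that a cube lies in its own
  triple.\<close>

lemma cube_subset_dilate:
  assumes "cube a l \<inter> cube b s \<noteq> {}" "l \<le> s"
  shows "cube a l \<subseteq> cube (\<chi> i. b $ i - s) (3 * s)"
proof
  fix y assume y: "y \<in> cube a l"
  obtain x where "x \<in> cube a l" "x \<in> cube b s" using assms(1) by blast
  then have *: "a $ i \<le> x $ i" "x $ i < a $ i + l" "b $ i \<le> x $ i" "x $ i < b $ i + s"
    "a $ i \<le> y $ i" "y $ i < a $ i + l" for i
    using y by (auto simp: cube_def)
  have "b $ i - s \<le> y $ i" "y $ i < b $ i - s + 3 * s" for i
    using *[of i] assms(2) by linarith+
  then show "y \<in> cube (\<chi> i. b $ i - s) (3 * s)" by (simp add: cube_def)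
qed

text \<open>The triple is itself a cube containing \<open>x\<close>, so its average competes in the
  supremum; \<open>3 ^ CARD('n)\<close> is the ratio of the volumes.\<close>

lemma nn_integral_cube_le_HL_maximal:
  fixes f :: "real^'n \<Rightarrow> real"
  assumes "0 < s" "x \<in> cube (\<chi> i. b $ i - s) (3 * s)"
  shows "(\<integral>\<^sup>+y\<in>cube (\<chi> i. b $ i - s) (3 * s). ennreal \<bar>f y\<bar> \<partial>lebesgue)
    \<le> ennreal (3 ^ CARD('n)) * emeasure lebesgue (cube b s) * HL_maximal f x"
proof -
  let ?Q = "cube (\<chi> i. b $ i - s) (3 * s)"
  have "(\<integral>\<^sup>+y\<in>?Q. ennreal \<bar>f y\<bar> \<partial>lebesgue) = avg ?Q (\<lambda>y. ennreal \<bar>f y\<bar>) * emeasure lebesgue ?Q"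
    using assms(1) by (intro avg_mult_emeasure[symmetric]) simp
  also have "\<dots> \<le> HL_maximal f x * emeasure lebesgue ?Q"
    using assms by (intro mult_right_mono avg_le_HL_maximal cube_in_cubes) auto
  also have "emeasure lebesgue ?Q = ennreal (3 ^ CARD('n)) * emeasure lebesgue (cube b s)"
    using assms(1) by (simp add: emeasure_lborel_cube power_mult_distrib ennreal_mult)
  finally show ?thesis by (simp add: mult_ac)
qed

text \<open>If a cube of \<open>F\<close> meeting \<open>R\<close> is larger than \<open>R\<close>, then its dilate contains \<open>x\<close>;
  otherwise the dilate of \<open>R\<close> contains all cubes of \<open>F\<close> meeting \<open>R\<close>.\<close>

lemma HL_maximal_indicator_le:
  fixes f :: "real^'n \<Rightarrow> real"
  assumes "finite F" "F \<subseteq> cubes" "disjoint F" and f: "f \<in> borel_measurable lebesgue"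
    and "0 < t" and F: "\<And>Q. Q \<in> F \<Longrightarrow> ennreal t < avg Q (\<lambda>y. ennreal \<bar>f y\<bar>)"
  shows "HL_maximal (indicator (\<Union>F)) x \<le> ennreal (3 ^ CARD('n) / t) * HL_maximal f x"
  unfolding HL_maximal_def[of "indicator (\<Union>F)"]
proof (rule SUP_least)
  fix R :: "(real^'n) set" assume "R \<in> {Q \<in> cubes. x \<in> Q}"
  then have "R \<in> cubes" "x \<in> R" by auto
  then obtain b s where R: "R = cube b s" "0 < s" "x \<in> cube b s" by (metis cubesE)
  let ?g = "\<lambda>y. ennreal \<bar>f y\<bar>" and ?m = "emeasure lebesgue" and ?K = "ennreal (3 ^ CARD('n))"
  have g: "?g \<in> borel_measurable lebesgue" using f by measurable
  have FQ: "ennreal t * ?m Q \<le> (\<integral>\<^sup>+y\<in>Q. ?g y \<partial>lebesgue)" if QF: "Q \<in> F" for Q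
  proof -
    obtain a l where Q: "Q = cube a l" "0 < l" using cubesE[OF subsetD[OF assms(2) QF]] .
    show ?thesis
      unfolding Q(1) avg_mult_emeasure[OF Q(2), symmetric]
      using F[OF QF] by (intro mult_right_mono) (auto simp: Q(1))
  qed
  have sF: "Q \<in> sets lebesgue" if "Q \<in> F" for Q using sets_cubes[OF subsetD[OF assms(2) that]] .
  have sR: "R \<in> sets lebesgue" using R(1) sets_cube by simp
  have UF: "\<Union>F \<in> sets lebesgue" using assms(1) sF by auto
  have int: "(\<integral>\<^sup>+y\<in>R. ennreal \<bar>indicator (\<Union>F) y\<bar> \<partial>lebesgue) = ?m (R \<inter> \<Union>F)"
  proof -
    have "ennreal \<bar>indicator (\<Union>F) y\<bar> * indicator R y = (indicator (R \<inter> \<Union>F) y :: ennreal)" for y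
      by (auto simp: indicator_def)
    then show ?thesis using sR UF by (simp add: nn_integral_indicator)
  qed
  have "ennreal t * ?m (R \<inter> \<Union>F) \<le> ?K * ?m R * HL_maximal f x"
  proof (cases "\<exists>a l. cube a l \<in> F \<and> cube a l \<inter> R \<noteq> {} \<and> s \<le> l")
    case True
    then obtain a l where Q: "cube a l \<in> F" "cube a l \<inter> R \<noteq> {}" "s \<le> l" by blast
    with R have l: "0 < l" by simp
    have sub: "cube b s \<subseteq> cube (\<chi> i. a $ i - l) (3 * l)"
      using Q R by (intro cube_subset_dilate) auto
    have sub': "cube a l \<subseteq> cube (\<chi> i. a $ i - l) (3 * l)"
      using Q R by (intro cube_subset_dilate) auto
    have "ennreal t * ?m (cube a l) \<le> (\<integral>\<^sup>+y\<in>cube a l. ?g y \<partial>lebesgue)"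
      using FQ Q(1) .
    also have "\<dots> \<le> (\<integral>\<^sup>+y\<in>cube (\<chi> i. a $ i - l) (3 * l). ?g y \<partial>lebesgue)"
      using sub' by (intro nn_integral_mono mult_left_mono) (auto simp: indicator_def)
    also have "\<dots> \<le> ?K * ?m (cube a l) * HL_maximal f x"
      using sub R l by (intro nn_integral_cube_le_HL_maximal) auto
    finally have "?m (cube a l) * ennreal t \<le> ?m (cube a l) * (?K * HL_maximal f x)"
      by (simp add: mult_ac)
    \<comment> \<open>The measure of the large cube cancels, leaving a lower bound for
      \<open>HL_maximal f x\<close> itself; the trivial estimate of
      \<open>R \<inter> \<Union>F\<close> by \<open>R\<close> then suffices.\<close>
    then have t: "ennreal t \<le> ?K * HL_maximal f x"
      using emeasure_cube_pos[OF l, of a] by (simp add: ennreal_mult_le_mult_iff)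
    have "ennreal t * ?m (R \<inter> \<Union>F) \<le> ennreal t * ?m R"
      using sR by (intro mult_left_mono emeasure_mono) auto
    also have "\<dots> \<le> (?K * HL_maximal f x) * ?m R" using t by (rule mult_right_mono) simp
    finally show ?thesis by (simp add: mult_ac)
  next
    case False
    \<comment> \<open>The cubes of \<open>F\<close> meeting \<open>R\<close> are now all shorter
      than \<open>R\<close>, hence inside its triple. Being disjoint, they contribute integrals of
      \<bar>f\<bar> that add up to at most the integral over the triple.\<close>
    define G where "G = {Q \<in> F. Q \<inter> R \<noteq> {}}"
    let ?R = "cube (\<chi> i. b $ i - s) (3 * s)"
    have GF: "G \<subseteq> F" and fG: "finite G" using assms(1) by (auto simp: G_def)
    have disj: "disjoint_family_on (\<lambda>Q. Q) G"
      unfolding disjoint_family_on_def using disjointD[OF assms(3)] GF by blast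
    have sub: "\<Union>G \<subseteq> ?R"
    proof
      fix y assume "y \<in> \<Union>G"
      then obtain Q where Q: "Q \<in> F" "Q \<inter> R \<noteq> {}" "y \<in> Q" by (auto simp: G_def)
      obtain a l where al: "Q = cube a l" using cubesE[OF subsetD[OF assms(2) Q(1)]] by blast
      have "\<not> s \<le> l" using False Q(1,2) unfolding al by blast
      then have "cube a l \<subseteq> ?R" using Q(2) unfolding al R(1) by (intro cube_subset_dilate) auto
      then show "y \<in> ?R" using Q(3) unfolding al by blast
    qed
    have "ennreal t * ?m (R \<inter> \<Union>F) \<le> ennreal t * ?m (\<Union>G)"
      using fG GF sF by (intro mult_left_mono emeasure_mono) (auto simp: G_def)
    also have "?m (\<Union>G) = ?m (\<Union>Q\<in>G. Q)" by simp
    also have "\<dots> = (\<Sum>Q\<in>G. ?m Q)"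
      using fG GF sF disj by (intro sum_emeasure[symmetric]) auto
    also have "ennreal t * \<dots> = (\<Sum>Q\<in>G. ennreal t * ?m Q)" by (simp add: sum_distrib_left)
    also have "\<dots> \<le> (\<Sum>Q\<in>G. (\<integral>\<^sup>+y\<in>Q. ?g y \<partial>lebesgue))"
      using GF by (intro sum_mono FQ) auto
    also have "\<dots> = (\<integral>\<^sup>+y. (\<Sum>Q\<in>G. ?g y * indicator Q y) \<partial>lebesgue)"
      using g GF sF by (intro nn_integral_sum[symmetric]) auto
    also have "\<dots> \<le> (\<integral>\<^sup>+y\<in>?R. ?g y \<partial>lebesgue)"
    proof (intro nn_integral_mono)
      fix y
      have "(\<Sum>Q\<in>G. ?g y * indicator Q y) = ?g y * (\<Sum>Q\<in>G. indicator Q y)"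
        by (simp only: sum_distrib_left)
      also have "(\<Sum>Q\<in>G. indicator Q y) = (indicator (\<Union>((\<lambda>Q. Q) ` G)) y :: ennreal)"
        by (rule indicator_UN_disjoint[OF fG disj, symmetric])
      also have "\<dots> \<le> indicator ?R y"
        using sub by (intro indicator_leI) auto
      finally show "(\<Sum>Q\<in>G. ?g y * indicator Q y) \<le> ?g y * indicator ?R y"
        by (simp add: mult_left_mono)
    qed
    also have "\<dots> \<le> ?K * ?m (cube b s) * HL_maximal f x"
      using R cube_subset_dilate[of b s b s] by (intro nn_integral_cube_le_HL_maximal) auto
    finally show ?thesis using R by simp
  qed
  then have "ennreal (1 / t) * (ennreal t * ?m (R \<inter> \<Union>F))
      \<le> ennreal (1 / t) * (?K * ?m R * HL_maximal f x)"
    by (rule mult_left_mono) simp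
  also have "ennreal (1 / t) * (?K * ?m R * HL_maximal f x)
      = ennreal (1 / t) * ?K * (?m R * HL_maximal f x)"
    by (simp only: mult.assoc)
  also have "ennreal (1 / t) * ?K = ennreal (3 ^ CARD('n) / t)"
    using \<open>0 < t\<close> by (simp flip: ennreal_mult)
  also have "ennreal (1 / t) * (ennreal t * ?m (R \<inter> \<Union>F)) = ?m (R \<inter> \<Union>F)"
    using \<open>0 < t\<close> by (simp add: mult.assoc[symmetric] ennreal_mult[symmetric])
  finally have "?m (R \<inter> \<Union>F) \<le> ?m R * (ennreal (3 ^ CARD('n) / t) * HL_maximal f x)"
    by (simp only: mult_ac)
  moreover have "0 < ?m R"
    unfolding R(1) using emeasure_cube_pos(1)[OF R(2)] by (simp only: zero_less_iff_neq_zero)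
  ultimately show "avg R (\<lambda>y. ennreal \<bar>indicator (\<Union>F) y\<bar>) \<le> ennreal (3 ^ CARD('n) / t) * HL_maximal f x"
    unfolding avg_def int by (intro divide_le_posI_ennreal)
qed

section \<open>Weighted measure of level sets\<close>

lemma wmeasure_eq_emeasure:
  assumes "w \<in> borel_measurable lebesgue" "E \<in> sets lebesgue"
  shows "wmeasure w E = emeasure (density lebesgue (\<lambda>x. ennreal (w x))) E"
  using assms by (simp add: wmeasure_def emeasure_density)

lemma wmeasure_mono: "A \<subseteq> B \<Longrightarrow> wmeasure w A \<le> wmeasure w B"
  unfolding wmeasure_def by (intro nn_integral_mono mult_left_mono) (auto simp: indicator_def)

lemma wmeasure_Un_le:
  assumes w: "w \<in> borel_measurable lebesgue" and "A \<in> sets lebesgue" "B \<in> sets lebesgue"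
  shows "wmeasure w (A \<union> B) \<le> wmeasure w A + wmeasure w B"
  using assms(2,3) emeasure_subadditive[of A "density lebesgue (\<lambda>x. ennreal (w x))" B]
  by (simp only: wmeasure_eq_emeasure[OF w] sets.Un sets_density)

lemma wmeasure_UN_finite_le:
  assumes w: "w \<in> borel_measurable lebesgue" and "finite I" "\<And>i. i \<in> I \<Longrightarrow> A i \<in> sets lebesgue"
  shows "wmeasure w (\<Union>i\<in>I. A i) \<le> (\<Sum>i\<in>I. wmeasure w (A i))"
proof -
  have "emeasure (density lebesgue (\<lambda>x. ennreal (w x))) (\<Union>i\<in>I. A i)
      \<le> (\<Sum>i\<in>I. emeasure (density lebesgue (\<lambda>x. ennreal (w x))) (A i))"
    using assms by (intro emeasure_subadditive_finite) auto
  then show ?thesis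
    using assms(2,3) by (simp add: wmeasure_eq_emeasure[OF w] sets.finite_UN)
qed

lemma wmeasure_UN_le:
  fixes A :: "nat \<Rightarrow> (real^'n) set"
  assumes w: "w \<in> borel_measurable lebesgue" and "\<And>i. A i \<in> sets lebesgue"
  shows "wmeasure w (\<Union>i. A i) \<le> (\<Sum>i. wmeasure w (A i))"
proof -
  have "emeasure (density lebesgue (\<lambda>x. ennreal (w x))) (\<Union>i. A i)
      \<le> (\<Sum>i. emeasure (density lebesgue (\<lambda>x. ennreal (w x))) (A i))"
    using assms by (intro emeasure_subadditive_countably) auto
  then show ?thesis
    using assms(2) by (simp add: wmeasure_eq_emeasure[OF w] sets.countable_UN)
qed

text \<open>Truncation of \<open>w\<close> at height \<open>t\<close>: where \<open>w > t\<close>,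
  the negative exponent \<open>1 - r\<close> gives \<open>w = w powr (1 - r) * w powr r \<le> t powr
  (1 - r) * w powr r\<close>.\<close>

lemma wmeasure_le_add:
  fixes w :: "real^'n \<Rightarrow> real"
  assumes w: "w \<in> borel_measurable lebesgue" "\<And>x. 0 \<le> w x"
    and "E \<in> sets lebesgue" "Q \<in> sets lebesgue" "E \<subseteq> Q" "1 < r" "0 < t"
  shows "wmeasure w E \<le> ennreal t * emeasure lebesgue E
    + ennreal (t powr (1 - r)) * (\<integral>\<^sup>+x\<in>Q. ennreal (w x powr r) \<partial>lebesgue)"
proof -
  note [measurable] = w(1) assms(3,4)
  have pointwise: "w x \<le> t + t powr (1 - r) * w x powr r" for x
  proof (cases "w x \<le> t")
    case True
    have "0 \<le> t powr (1 - r) * w x powr r" by simp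
    with True show ?thesis by linarith
  next
    case False
    have "w x = w x powr (1 - r) * w x powr r"
      using False assms(7) by (simp flip: powr_add)
    also have "\<dots> \<le> t powr (1 - r) * w x powr r"
      using False assms(6,7) by (intro mult_right_mono powr_mono2') auto
    finally show ?thesis using assms(7) by linarith
  qed
  have "wmeasure w E \<le> (\<integral>\<^sup>+x. ennreal t * indicator E x
      + ennreal (t powr (1 - r)) * (ennreal (w x powr r) * indicator Q x) \<partial>lebesgue)"
    unfolding wmeasure_def
  proof (rule nn_integral_mono)
    fix x
    have "ennreal (w x) \<le> ennreal (t + t powr (1 - r) * w x powr r)"
      using pointwise by (rule ennreal_leI)
    also have "\<dots> = ennreal t + ennreal (t powr (1 - r)) * ennreal (w x powr r)"
      using assms(7) by (simp add: ennreal_plus ennreal_mult)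
    finally show "ennreal (w x) * indicator E x \<le> ennreal t * indicator E x
      + ennreal (t powr (1 - r)) * (ennreal (w x powr r) * indicator Q x)"
      using assms(5) by (auto simp: indicator_def)
  qed
  also have "\<dots> = (\<integral>\<^sup>+x. ennreal t * indicator E x \<partial>lebesgue)
      + (\<integral>\<^sup>+x. ennreal (t powr (1 - r)) * (ennreal (w x powr r) * indicator Q x) \<partial>lebesgue)"
    by (intro nn_integral_add) measurable
  also have "(\<integral>\<^sup>+x. ennreal t * indicator E x \<partial>lebesgue) = ennreal t * emeasure lebesgue E"
    using assms(3) by (simp add: nn_integral_cmult_indicator)
  also have "(\<integral>\<^sup>+x. ennreal (t powr (1 - r)) * (ennreal (w x powr r) * indicator Q x) \<partial>lebesgue)
      = ennreal (t powr (1 - r)) * (\<integral>\<^sup>+x\<in>Q. ennreal (w x powr r) \<partial>lebesgue)"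
    by (intro nn_integral_cmult) measurable
  finally show ?thesis .
qed

text \<open>A substitute for Hoelder's inequality, obtained from \<open>wmeasure_le_add\<close> by optimizing \<open>t\<close>.\<close>

lemma wmeasure_le_avg_powr:
  fixes w :: "real^'n \<Rightarrow> real"
  assumes w: "w \<in> borel_measurable lebesgue" "\<And>x. 0 \<le> w x"
    and E: "E \<in> sets lebesgue" "E \<subseteq> Q" and Q: "Q \<in> cubes" and "1 < r" "0 < \<epsilon>"
    and small: "emeasure lebesgue E \<le> ennreal \<epsilon> * emeasure lebesgue Q"
  shows "wmeasure w E \<le> ennreal (2 * \<epsilon> powr (1 - 1 / r)) *
    (ennpow (avg Q (\<lambda>x. ennreal (w x powr r))) (1 / r) * emeasure lebesgue Q)"
proof -
  obtain a l where al: "Q = cube a l" "0 < l" using cubesE[OF Q] .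
  define v where "v = l ^ CARD('n)"
  have v: "0 < v" "emeasure lebesgue Q = ennreal v"
    using al by (simp_all add: v_def emeasure_lborel_cube)
  define A where "A = avg Q (\<lambda>x. ennreal (w x powr r))"
  have J: "(\<integral>\<^sup>+x\<in>Q. ennreal (w x powr r) \<partial>lebesgue) = A * ennreal v"
    using avg_mult_emeasure[OF al(2), of a "\<lambda>x. ennreal (w x powr r)"] v(2) by (simp only: A_def al)
  have *: "wmeasure w E \<le> ennreal t * (ennreal \<epsilon> * ennreal v) + ennreal (t powr (1 - r)) * (A * ennreal v)"
    if "0 < t" for t
  proof -
    have "wmeasure w E \<le> ennreal t * emeasure lebesgue E
        + ennreal (t powr (1 - r)) * (\<integral>\<^sup>+x\<in>Q. ennreal (w x powr r) \<partial>lebesgue)"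
      by (rule wmeasure_le_add[OF w E(1) sets_cubes[OF Q] E(2) \<open>1 < r\<close> that])
    also have "\<dots> \<le> ennreal t * (ennreal \<epsilon> * ennreal v) + ennreal (t powr (1 - r)) * (A * ennreal v)"
      unfolding J using small v by (intro add_right_mono mult_left_mono) auto
    finally show ?thesis .
  qed
  have "wmeasure w E \<le> ennreal (2 * \<epsilon> powr (1 - 1 / r)) * (ennpow A (1 / r) * ennreal v)"
  proof (cases A)
    case top
    \<comment> \<open>The product of 0 and infinity is 0 in \<open>ennreal\<close>, so it is the
      positivity of \<epsilon> and \<open>v\<close> that makes the right-hand side infinite.\<close>
    then show ?thesis using v(1) \<open>0 < \<epsilon>\<close>
      by (simp add: ennpow_top ennreal_top_mult ennreal_mult_top)
  next
    case (real V)
    show ?thesis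
    proof (cases "V = 0")
      case True
      \<comment> \<open>The optimal height would be 0 here; instead
        \<open>t = e / (\<epsilon> * v)\<close> is made arbitrarily small.\<close>
      have "wmeasure w E \<le> 0 + ennreal e" if "0 < e" for e
      proof -
        have "wmeasure w E \<le> ennreal (e / (\<epsilon> * v)) * (ennreal \<epsilon> * ennreal v)"
          using *[of "e / (\<epsilon> * v)"] that \<open>0 < \<epsilon>\<close> v(1) real True by simp
        also have "\<dots> = ennreal e"
          using that \<open>0 < \<epsilon>\<close> v(1) by (simp flip: ennreal_mult)
        finally show ?thesis by simp
      qed
      then have "wmeasure w E \<le> 0" by (rule ennreal_le_epsilon)
      then show ?thesis by simp
    next
      case False
      define B where "B = V powr (1 / r)"
      have B: "0 < B" "V = B powr r" using False real \<open>1 < r\<close> by (simp_all add: B_def powr_powr)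
      \<comment> \<open>This height balances the two terms: each becomes
        \<open>B * \<epsilon> powr (1 - 1 / r) * v\<close>, whence the factor 2.\<close>
      define t where "t = B * \<epsilon> powr (- (1 / r))"
      have t: "0 < t" using B \<open>0 < \<epsilon>\<close> by (simp add: t_def)
      have t1: "t * \<epsilon> = B * \<epsilon> powr (1 - 1 / r)"
        using \<open>0 < \<epsilon>\<close> by (simp add: t_def powr_diff powr_minus field_simps)
      have "t powr (1 - r) * V = (B powr (1 - r) * B powr r) * (\<epsilon> powr (- (1 / r))) powr (1 - r)"
        using B \<open>0 < \<epsilon>\<close> by (simp add: t_def powr_mult)
      also have "B powr (1 - r) * B powr r = B" using B by (simp flip: powr_add)
      also have "(\<epsilon> powr (- (1 / r))) powr (1 - r) = \<epsilon> powr (1 - 1 / r)"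
      proof -
        have "- (1 / r) * (1 - r) = 1 - 1 / r" using \<open>1 < r\<close> by (simp add: field_simps)
        then show ?thesis by (simp only: powr_powr)
      qed
      finally have t2: "t powr (1 - r) * V = B * \<epsilon> powr (1 - 1 / r)" .
      have "wmeasure w E \<le> ennreal (t * \<epsilon> * v + t powr (1 - r) * V * v)"
        using *[OF t] real t v(1) \<open>0 < \<epsilon>\<close>
        by (simp add: mult.assoc flip: ennreal_mult ennreal_plus)
      also have "t * \<epsilon> * v + t powr (1 - r) * V * v = 2 * \<epsilon> powr (1 - 1 / r) * (B * v)"
        unfolding t1 t2 by simp
      also have "ennreal \<dots> = ennreal (2 * \<epsilon> powr (1 - 1 / r)) * (ennpow A (1 / r) * ennreal v)"
        using real v(1) B(1) by (simp add: ennpow_ennreal ennreal_mult flip: B_def)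
      finally show ?thesis .
    qed
  qed
  then show ?thesis using v(2) by (simp only: A_def)
qed

text \<open>On each maximal cube, sparseness leaves the fraction \<open>(1 - \<eta>) ^ k\<close>,
  which the Hoelder substitute raises to the power \<open>1 - 1 / r\<close> at the cost of a factor
  2. Summing over these disjoint cubes by the \<open>SC\<close> inequality costs \<open>C\<close>,
  and comparing the maximal functions costs \<open>(3 ^ CARD('n) / t) powr p\<close>.\<close>

lemma wmeasure_level_set_le:
  fixes w f :: "real^'n \<Rightarrow> real"
  assumes w: "w \<in> borel_measurable lebesgue" "\<And>x. 0 \<le> w x" and f: "f \<in> borel_measurable lebesgue"
    and T: "finite T" "T \<subseteq> cubes" "laminar T" "sparse_family \<eta> T" and \<eta>: "0 < \<eta>" "\<eta> < 1"
    and "0 < p" "0 < C" "1 < r" "0 < t"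
    and SC: "\<And>F. F \<subseteq> cubes \<Longrightarrow> disjoint F \<Longrightarrow>
        (\<Sum>\<^sub>\<infinity>Q\<in>F. ennpow (avg Q (\<lambda>x. ennreal (w x powr r))) (1 / r) * emeasure lebesgue Q)
          \<le> ennreal C * (\<integral>\<^sup>+x. ennpow (HL_maximal (indicator (\<Union>F)) x) p * ennreal (w x) \<partial>lebesgue)"
    and large: "\<And>Q. Q \<in> T \<Longrightarrow> ennreal t < avg Q (\<lambda>y. ennreal \<bar>f y\<bar>)"
  shows "wmeasure w (level_set k T)
    \<le> ennreal (2 * C * ((1 - \<eta>) powr (1 - 1 / r)) ^ k * (3 ^ CARD('n) / t) powr p)
      * (\<integral>\<^sup>+x. ennpow (HL_maximal f x) p * ennreal (w x) \<partial>lebesgue)"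
proof -
  define F where "F = maximal_sets T"
  have FT: "F \<subseteq> T" and fF: "finite F"
    using maximal_sets_subset[of T] finite_subset[OF maximal_sets_subset T(1)] by (simp_all add: F_def)
  have F: "F \<subseteq> cubes" "disjoint F"
    using FT T(2) disjoint_maximal_sets[OF T(3)] by (auto simp: F_def)
  have sT: "T \<subseteq> sets lebesgue" using T(2) sets_cubes by auto
  have lev: "level_set k T \<in> sets lebesgue"
    using sets_level_set[OF T(1) sT] by simp
  let ?A = "\<lambda>Q. ennpow (avg Q (\<lambda>x. ennreal (w x powr r))) (1 / r) * emeasure lebesgue Q"
  let ?c = "2 * ((1 - \<eta>) ^ k) powr (1 - 1 / r)"
  let ?d = "3 ^ CARD('n) / t"
  let ?I = "\<integral>\<^sup>+x. ennpow (HL_maximal f x) p * ennreal (w x) \<partial>lebesgue"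
  have each: "wmeasure w (Q \<inter> level_set k T) \<le> ennreal ?c * ?A Q" if "Q \<in> F" for Q
  proof (rule wmeasure_le_avg_powr[OF w])
    show "Q \<in> cubes" using F that by auto
    then show "Q \<inter> level_set k T \<in> sets lebesgue" using lev sets_cubes by auto
    have "emeasure lebesgue (Q \<inter> level_set k T) \<le> ennreal (1 - \<eta>) ^ k * emeasure lebesgue Q"
      using that T(4) unfolding F_def sparse_family_def
      by (intro emeasure_level_set_le[OF T(1) sT _ T(3)]) auto
    then show "emeasure lebesgue (Q \<inter> level_set k T) \<le> ennreal ((1 - \<eta>) ^ k) * emeasure lebesgue Q"
      using \<eta> by (simp add: ennreal_power)
  qed (use \<eta> \<open>1 < r\<close> in auto)
  have "level_set k T = (\<Union>Q\<in>F. Q \<inter> level_set k T)"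
    using level_set_subset_Union[of k T] Union_maximal_sets[OF T(1)] unfolding F_def by auto
  then have "wmeasure w (level_set k T) = wmeasure w (\<Union>Q\<in>F. Q \<inter> level_set k T)" by simp
  also have "\<dots> \<le> (\<Sum>Q\<in>F. wmeasure w (Q \<inter> level_set k T))"
    using sT FT lev by (intro wmeasure_UN_finite_le[OF w(1) fF]) auto
  also have "\<dots> \<le> (\<Sum>Q\<in>F. ennreal ?c * ?A Q)" by (intro sum_mono each)
  also have "\<dots> = ennreal ?c * (\<Sum>\<^sub>\<infinity>Q\<in>F. ?A Q)"
    using fF by (simp add: sum_distrib_left)
  also have "\<dots> \<le> ennreal ?c *
      (ennreal C * (\<integral>\<^sup>+x. ennpow (HL_maximal (indicator (\<Union>F)) x) p * ennreal (w x) \<partial>lebesgue))"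
    by (intro mult_left_mono SC F) simp
  also have "(\<integral>\<^sup>+x. ennpow (HL_maximal (indicator (\<Union>F)) x) p * ennreal (w x) \<partial>lebesgue)
      \<le> (\<integral>\<^sup>+x. ennreal (?d powr p) * (ennpow (HL_maximal f x) p * ennreal (w x)) \<partial>lebesgue)"
  proof (rule nn_integral_mono)
    fix x
    have "HL_maximal (indicator (\<Union>F)) x \<le> ennreal ?d * HL_maximal f x"
      using FT large by (intro HL_maximal_indicator_le[OF fF F f \<open>0 < t\<close>]) auto
    then have "ennpow (HL_maximal (indicator (\<Union>F)) x) p \<le> ennpow (ennreal ?d * HL_maximal f x) p"
      using \<open>0 < p\<close> by (rule ennpow_mono[rotated])
    also have "\<dots> = ennreal (?d powr p) * ennpow (HL_maximal f x) p"
      using \<open>0 < t\<close> by (intro ennpow_cmult) simp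
    finally show "ennpow (HL_maximal (indicator (\<Union>F)) x) p * ennreal (w x)
        \<le> ennreal (?d powr p) * (ennpow (HL_maximal f x) p * ennreal (w x))"
      unfolding mult.assoc[symmetric] by (rule mult_right_mono) simp
  qed
  also have "\<dots> \<le> ennreal (?d powr p) * ?I"
    using \<open>0 < t\<close> by (intro nn_integral_cmult_le) simp
  also have "ennreal ?c * (ennreal C * (ennreal (?d powr p) * ?I))
      = ennreal (?c * C * ?d powr p) * ?I"
    using \<open>0 < C\<close> by (simp add: ennreal_mult mult.assoc)
  also have "?c * C * ?d powr p = 2 * C * ((1 - \<eta>) powr (1 - 1 / r)) ^ k * ?d powr p"
    using \<eta> by (simp add: powr_powr mult.commute flip: powr_realpow)
  finally show ?thesis
    by (simp add: mult_left_mono)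
qed

text \<open>Ratio test: as \<open>2 ^ Suc m\<close> is twice \<open>2 ^ m\<close>, the quotient of
  consecutive terms is \<open>q ^ 2 ^ m * b\<close>, which tends to 0 for every
  \<open>b\<close>.\<close>

lemma summable_power_power_mult_power:
  fixes q b :: real
  assumes "0 \<le> q" "q < 1" "0 \<le> b"
  shows "summable (\<lambda>m. q ^ 2 ^ m * b ^ m)"
proof -
  have "strict_mono (\<lambda>m. 2 ^ m :: nat)" by (simp add: strict_mono_def)
  then have "(\<lambda>m. q ^ 2 ^ m) \<longlonglongrightarrow> 0"
    using LIMSEQ_subseq_LIMSEQ[OF LIMSEQ_power_zero[of q], of "\<lambda>m. 2 ^ m"] assms by (simp add: o_def)
  then have "(\<lambda>m. q ^ 2 ^ m * b) \<longlonglongrightarrow> 0" by (rule tendsto_mult_left_zero)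
  then have "\<forall>\<^sub>F m in sequentially. q ^ 2 ^ m * b < 1 / 2"
    by (rule order_tendstoD) simp
  then obtain N where N: "\<And>m. m \<ge> N \<Longrightarrow> q ^ 2 ^ m * b < 1 / 2"
    by (auto simp: eventually_sequentially)
  show ?thesis
  proof (rule summable_ratio_test[of "1 / 2" N])
    fix m assume "N \<le> m"
    have "q ^ 2 ^ Suc m * b ^ Suc m = (q ^ 2 ^ m * b) * (q ^ 2 ^ m * b ^ m)"
      by (simp add: mult_2 power_add)
    also have "\<dots> \<le> 1 / 2 * (q ^ 2 ^ m * b ^ m)"
      using N[OF \<open>N \<le> m\<close>] assms by (intro mult_right_mono) auto
    finally show "norm (q ^ 2 ^ Suc m * b ^ Suc m) \<le> 1 / 2 * norm (q ^ 2 ^ m * b ^ m)"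
      using assms by simp
  qed simp
qed

lemma sparse_family_subset:
  assumes "sparse_family \<eta> S" "countable S" "S \<subseteq> cubes" "T \<subseteq> S"
  shows "sparse_family \<eta> T"
  unfolding sparse_family_def
proof
  fix Q assume "Q \<in> T"
  \<comment> \<open>\<open>emeasure\<close> is 0 on non-measurable sets, so its monotonicity
    requires the larger union to be measurable; countability of \<open>S\<close> provides
    this.\<close>
  have "\<Union>{Q' \<in> S. Q' \<subset> Q} \<in> sets lebesgue"
    using assms(2,3) sets_cubes by (intro sets.countable_Union) (auto intro: countable_subset)
  moreover have "\<Union>{Q' \<in> T. Q' \<subset> Q} \<subseteq> \<Union>{Q' \<in> S. Q' \<subset> Q}" using assms(4) by blast
  ultimately have "emeasure lebesgue (\<Union>{Q' \<in> T. Q' \<subset> Q}) \<le> emeasure lebesgue (\<Union>{Q' \<in> S. Q' \<subset> Q})"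
    by (intro emeasure_mono)
  also have "\<dots> \<le> ennreal (1 - \<eta>) * emeasure lebesgue Q"
    using assms(1,4) \<open>Q \<in> T\<close> unfolding sparse_family_def by auto
  finally show "emeasure lebesgue (\<Union>{Q' \<in> T. Q' \<subset> Q}) \<le> ennreal (1 - \<eta>) * emeasure lebesgue Q" .
qed

section \<open>Superlevel sets of sparse operators\<close>

definition large_cubes :: "(real^'n) set set \<Rightarrow> (real^'n \<Rightarrow> real) \<Rightarrow> real \<Rightarrow> (real^'n) set set" where
  "large_cubes S f \<alpha> = {Q \<in> S. ennreal (\<alpha> / 2) < avg Q (\<lambda>y. ennreal \<bar>f y\<bar>)}"

text \<open>The ratio 4 between thresholds beats the overlap \<open>2 ^ m\<close> that will be
  tolerated in layer \<open>m\<close>. The ranges, open below and closed above, fit together and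
  continue those of \<open>large_cubes\<close> downwards to 0.\<close>

definition layer ::
  "(real^'n) set set \<Rightarrow> (real^'n \<Rightarrow> real) \<Rightarrow> real \<Rightarrow> nat \<Rightarrow> (real^'n) set set" where
  "layer S f \<alpha> m = {Q \<in> S. ennreal (\<alpha> / (2 * 4 ^ Suc m)) < avg Q (\<lambda>y. ennreal \<bar>f y\<bar>)
     \<and> avg Q (\<lambda>y. ennreal \<bar>f y\<bar>) \<le> ennreal (\<alpha> / (2 * 4 ^ m))}"

lemma in_layerI:
  assumes "0 < \<alpha>" "Q \<in> S" "Q \<notin> large_cubes S f \<alpha>" "avg Q (\<lambda>y. ennreal \<bar>f y\<bar>) \<noteq> 0"
  shows "\<exists>m. Q \<in> layer S f \<alpha> m"
proof -
  define a where "a = avg Q (\<lambda>y. ennreal \<bar>f y\<bar>)"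
  have "a \<le> ennreal (\<alpha> / 2)" using assms(2,3) by (simp add: large_cubes_def a_def not_less)
  then obtain b where b: "a = ennreal b" "0 < b" "b \<le> \<alpha> / 2"
    using assms(1,4) by (cases a) (auto simp: a_def[symmetric] top_unique)
  have "(\<lambda>m. \<alpha> / 2 * (1 / 4) ^ Suc m) \<longlonglongrightarrow> 0"
    by (intro tendsto_mult_right_zero LIMSEQ_Suc LIMSEQ_power_zero) simp
  then have "\<forall>\<^sub>F m in sequentially. \<alpha> / 2 * (1 / 4) ^ Suc m < b"
    using b(2) by (rule order_tendstoD)
  then obtain n where n: "\<alpha> / (2 * 4 ^ Suc n) < b"
    unfolding eventually_sequentially by (auto simp: power_divide)
  \<comment> \<open>Such an index exists because the thresholds tend to 0. Minimality gives the
    upper bound of the layer, and for \<open>m = 0\<close> that bound is the failure of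
    \<open>Q\<close> to be large.\<close>
  define m where "m = (LEAST m. \<alpha> / (2 * 4 ^ Suc m) < b)"
  have m1: "\<alpha> / (2 * 4 ^ Suc m) < b" unfolding m_def by (rule LeastI[of _ n]) (rule n)
  have m2: "b \<le> \<alpha> / (2 * 4 ^ m)"
  proof (cases m)
    case (Suc k)
    then have "\<not> \<alpha> / (2 * 4 ^ Suc k) < b"
      using not_less_Least[of k "\<lambda>m. \<alpha> / (2 * 4 ^ Suc m) < b"] unfolding m_def by simp
    then show ?thesis using Suc by simp
  qed (use b in simp)
  have "Q \<in> layer S f \<alpha> m"
    using assms(1,2) m1 m2 b(1,2) by (simp add: layer_def ennreal_less_iff flip: a_def)
  then show ?thesis ..
qed

text \<open>Layer \<open>m\<close> contributes at most \<open>2 ^ m * (\<alpha> / (2 * 4 ^ m)) = \<alpha> / 2 ^ (m + 1)\<close> off its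
  level set.\<close>

lemma sparse_operator_superlevel_subset:
  assumes "finite S" "0 < \<alpha>"
  shows "{x. ennreal \<alpha> < sparse_operator S f x}
    \<subseteq> \<Union>(large_cubes S f \<alpha>) \<union> (\<Union>m. level_set (2 ^ m) (layer S f \<alpha> m))"
proof (rule subsetI, rule ccontr)
  fix x
  assume "x \<in> {x. ennreal \<alpha> < sparse_operator S f x}"
    and x: "x \<notin> \<Union>(large_cubes S f \<alpha>) \<union> (\<Union>m. level_set (2 ^ m) (layer S f \<alpha> m))"
  then have gt: "ennreal \<alpha> < sparse_operator S f x" by simp
  let ?a = "\<lambda>Q. avg Q (\<lambda>y. ennreal \<bar>f y\<bar>)" and ?L = "layer S f \<alpha>"
  let ?g = "\<lambda>m Q. if Q \<in> ?L m then ?a Q * indicator Q x else 0"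
  \<comment> \<open>A cube through \<open>x\<close> cannot be large, so its average is either zero
    or recorded in some layer.\<close>
  have each: "?a Q * indicator Q x \<le> (\<Sum>m. ?g m Q)" if QS: "Q \<in> S" for Q
  proof (cases "x \<in> Q \<and> ?a Q \<noteq> 0")
    case True
    then obtain m where "Q \<in> ?L m"
      using in_layerI[OF assms(2) QS, of f] x by auto
    then have "?a Q * indicator Q x = sum (\<lambda>m. ?g m Q) {m}" by simp
    also have "\<dots> \<le> (\<Sum>m. ?g m Q)" by (intro sum_le_suminf) auto
    finally show ?thesis .
  qed auto
  have layer: "(\<Sum>Q\<in>S. ?g m Q) \<le> ennreal (\<alpha> * (1 / 2) ^ Suc m)" for m
  proof -
    have "(\<Sum>Q\<in>S. ?g m Q) = (\<Sum>Q\<in>{Q \<in> ?L m. x \<in> Q}. ?a Q)"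
      using assms(1) by (intro sum.mono_neutral_cong_right) (auto simp: layer_def indicator_def)
    also have "\<dots> \<le> of_nat (card {Q \<in> ?L m. x \<in> Q}) * ennreal (\<alpha> / (2 * 4 ^ m))"
      by (intro sum_bounded_above) (simp add: layer_def)
    also have "\<dots> \<le> of_nat (2 ^ m) * ennreal (\<alpha> / (2 * 4 ^ m))"
    proof (intro mult_right_mono of_nat_mono)
      show "card {Q \<in> ?L m. x \<in> Q} \<le> 2 ^ m"
        using x by (auto simp: level_set_def not_less)
    qed simp
    also have "\<dots> = ennreal (2 ^ m * (\<alpha> / (2 * 4 ^ m)))"
      using assms(2) unfolding ennreal_of_nat_eq_real_of_nat by (simp flip: ennreal_mult)
    also have "2 ^ m * (\<alpha> / (2 * 4 ^ m)) = \<alpha> * (1 / 2) ^ Suc m"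
    proof -
      have "(4::real) ^ m = 2 ^ m * 2 ^ m" by (simp flip: power_mult_distrib)
      then show ?thesis by (simp add: power_divide)
    qed
    finally show ?thesis .
  qed
  have "sparse_operator S f x = (\<Sum>Q\<in>S. ?a Q * indicator Q x)"
    using assms(1) by (simp add: sparse_operator_def)
  also have "\<dots> \<le> (\<Sum>Q\<in>S. \<Sum>m. ?g m Q)" by (intro sum_mono each)
  also have "\<dots> = (\<Sum>m. \<Sum>Q\<in>S. ?g m Q)" by (rule suminf_sum[symmetric]) auto
  also have "\<dots> \<le> (\<Sum>m. ennreal (\<alpha> * (1 / 2) ^ Suc m))"
    by (intro suminf_le layer) auto
  \<comment> \<open>The bounds of the layers add up to exactly \<alpha>, which contradicts the
    strict inequality at \<open>x\<close>.\<close>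
  also have "\<dots> = ennreal \<alpha>"
  proof (rule suminf_ennreal_eq)
    show "(\<lambda>m. \<alpha> * (1 / 2) ^ Suc m) sums \<alpha>"
      using sums_mult[OF power_half_series, of \<alpha>] by simp
  qed (use assms(2) in simp)
  finally show False using gt by simp
qed

text \<open>Chebyshev's inequality in pointwise form: every point of a large cube has
  \<open>HL_maximal f x \<ge> \<alpha> / 2\<close>, so the indicator of the union is dominated
  before integrating.\<close>

lemma wmeasure_large_cubes_le:
  fixes w f :: "real^'n \<Rightarrow> real"
  assumes w: "w \<in> borel_measurable lebesgue" "\<And>x. 0 \<le> w x"
    and "finite S" "S \<subseteq> cubes" "0 < \<alpha>" "0 < p"
  shows "wmeasure w (\<Union>(large_cubes S f \<alpha>))
    \<le> ennreal ((2 / \<alpha>) powr p) * (\<integral>\<^sup>+x. ennpow (HL_maximal f x) p * ennreal (w x) \<partial>lebesgue)"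
proof -
  let ?E = "\<Union>(large_cubes S f \<alpha>)"
  have "wmeasure w ?E
      \<le> (\<integral>\<^sup>+x. ennreal ((2 / \<alpha>) powr p) * (ennpow (HL_maximal f x) p * ennreal (w x)) \<partial>lebesgue)"
    unfolding wmeasure_def
  proof (rule nn_integral_mono)
    fix x
    show "ennreal (w x) * indicator ?E x
      \<le> ennreal ((2 / \<alpha>) powr p) * (ennpow (HL_maximal f x) p * ennreal (w x))"
    proof (cases "x \<in> ?E")
      case True
      then obtain Q where Q: "Q \<in> S" "x \<in> Q" "ennreal (\<alpha> / 2) < avg Q (\<lambda>y. ennreal \<bar>f y\<bar>)"
        by (auto simp: large_cubes_def)
      then have "ennreal (\<alpha> / 2) \<le> HL_maximal f x"
        using avg_le_HL_maximal[of Q x f] assms(4) by (auto dest: subsetD)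
      then have "ennpow (ennreal (2 / \<alpha>) * ennreal (\<alpha> / 2)) p \<le> ennpow (ennreal (2 / \<alpha>) * HL_maximal f x) p"
        using assms(6) by (intro ennpow_mono mult_left_mono) auto
      moreover have "ennpow (ennreal (2 / \<alpha>) * ennreal (\<alpha> / 2)) p = 1"
        using assms(5) ennpow_ennreal[of 1 p] by (simp flip: ennreal_mult)
      ultimately have "1 \<le> ennreal ((2 / \<alpha>) powr p) * ennpow (HL_maximal f x) p"
        using assms(5) by (simp add: ennpow_cmult)
      from mult_right_mono[OF this, of "ennreal (w x)"] show ?thesis
        using True by (simp add: mult.assoc)
    qed simp
  qed
  also have "\<dots> \<le> ennreal ((2 / \<alpha>) powr p) * (\<integral>\<^sup>+x. ennpow (HL_maximal f x) p * ennreal (w x) \<partial>lebesgue)"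
    using assms(5) by (intro nn_integral_cmult_le) simp
  finally show ?thesis .
qed

lemma sets_superlevel_sparse_operator:
  assumes "finite S" "S \<subseteq> cubes"
  shows "{x. ennreal \<alpha> < sparse_operator S f x} \<in> sets lebesgue"
proof -
  have "(\<lambda>x. \<Sum>Q\<in>S. avg Q (\<lambda>y. ennreal \<bar>f y\<bar>) * indicator Q x) \<in> borel_measurable lebesgue"
    using assms sets_cubes
    by (intro borel_measurable_sum borel_measurable_times_ennreal borel_measurable_indicator) auto
  then have "{x \<in> space lebesgue. ennreal \<alpha> < (\<Sum>Q\<in>S. avg Q (\<lambda>y. ennreal \<bar>f y\<bar>) * indicator Q x)}
      \<in> sets lebesgue"
    by measurable
  then show ?thesis using assms(1) by (simp add: sparse_operator_def)
qed

text \<open>In \<open>K\<close>, the term \<open>2 powr p\<close> comes from the large cubes and the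
  \<open>m\<close>-th term of the series from layer \<open>m\<close>, with overlap
  \<open>2 ^ m\<close> and the lower threshold of the layer as \<open>t\<close>. Since
  \<open>K\<close> involves neither \<open>S\<close> nor \<open>f\<close> nor \<alpha>, the bound
  survives the passage to infinite families.\<close>

lemma wmeasure_superlevel_finite_le:
  fixes w f :: "real^'n \<Rightarrow> real" and \<eta> p C r :: real
  defines "q \<equiv> (1 - \<eta>) powr (1 - 1 / r)"
  defines "K \<equiv> 2 powr p + (\<Sum>m. 2 * C * q ^ 2 ^ m * (3 ^ CARD('n) * (2 * 4 ^ Suc m)) powr p)"
  assumes w: "w \<in> borel_measurable lebesgue" "\<And>x. 0 \<le> w x" and f: "f \<in> borel_measurable lebesgue"
    and S: "finite S" "S \<subseteq> cubes" "laminar S" "sparse_family \<eta> S" and \<eta>: "0 < \<eta>" "\<eta> < 1"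
    and "0 < p" "0 < C" "1 < r" "0 < \<alpha>"
    and SC: "\<And>F. F \<subseteq> cubes \<Longrightarrow> disjoint F \<Longrightarrow>
        (\<Sum>\<^sub>\<infinity>Q\<in>F. ennpow (avg Q (\<lambda>x. ennreal (w x powr r))) (1 / r) * emeasure lebesgue Q)
          \<le> ennreal C * (\<integral>\<^sup>+x. ennpow (HL_maximal (indicator (\<Union>F)) x) p * ennreal (w x) \<partial>lebesgue)"
  shows "wmeasure w {x. ennreal \<alpha> < sparse_operator S f x}
    \<le> ennreal (K * \<alpha> powr - p) * (\<integral>\<^sup>+x. ennpow (HL_maximal f x) p * ennreal (w x) \<partial>lebesgue)"
proof -
  let ?I = "\<integral>\<^sup>+x. ennpow (HL_maximal f x) p * ennreal (w x) \<partial>lebesgue"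
  define c where "c = (\<lambda>m. 2 * C * q ^ 2 ^ m * (3 ^ CARD('n) * (2 * 4 ^ Suc m)) powr p)"
  have q: "0 \<le> q" "q < 1"
    using \<eta> \<open>1 < r\<close> powr_less_mono2[of "1 - 1 / r" "1 - \<eta>" 1] by (simp_all add: q_def)
  \<comment> \<open>Writing \<open>2 * 4 ^ Suc m\<close> as \<open>8 * 4 ^ m\<close> isolates the
    geometric growth \<open>(4 powr p) ^ m\<close>, which the decay of \<open>q ^ 2 ^ m\<close>
    absorbs.\<close>
  have c_eq: "c m = (2 * C * (3 ^ CARD('n) * 8) powr p) * (q ^ 2 ^ m * (4 powr p) ^ m)" for m
  proof -
    have "(3 ^ CARD('n) * (2 * 4 ^ Suc m)) powr p = ((3 ^ CARD('n) * 8) * 4 ^ m) powr p"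
      by (simp add: mult.assoc)
    also have "\<dots> = (3 ^ CARD('n) * 8) powr p * (4 powr p) ^ m"
      by (simp only: powr_mult) (simp add: powr_powr mult.commute flip: powr_realpow)
    finally show ?thesis by (simp add: c_def)
  qed
  have c: "summable c"
    using summable_mult[OF summable_power_power_mult_power[of q "4 powr p"],
      of "2 * C * (3 ^ CARD('n) * 8) powr p"] q
    by (simp add: c_eq[symmetric] del: summable_cmult_iff)
  have c0: "0 \<le> c m" for m using q \<open>0 < C\<close> by (simp add: c_def)
  have layer: "wmeasure w (level_set (2 ^ m) (layer S f \<alpha> m)) \<le> ennreal (c m * \<alpha> powr - p) * ?I" for m
  proof -
    have sub: "layer S f \<alpha> m \<subseteq> S" by (auto simp: layer_def)
    have "wmeasure w (level_set (2 ^ m) (layer S f \<alpha> m))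
        \<le> ennreal (2 * C * q ^ 2 ^ m * (3 ^ CARD('n) / (\<alpha> / (2 * 4 ^ Suc m))) powr p) * ?I"
      unfolding q_def
    proof (rule wmeasure_level_set_le[OF w f _ _ _ _ \<eta> \<open>0 < p\<close> \<open>0 < C\<close> \<open>1 < r\<close> _ SC])
      show "finite (layer S f \<alpha> m)" "layer S f \<alpha> m \<subseteq> cubes"
        using sub S finite_subset by auto
      show "laminar (layer S f \<alpha> m)" using laminar_subset[OF S(3) sub] .
      show "sparse_family \<eta> (layer S f \<alpha> m)"
        using sparse_family_subset[OF S(4) countable_finite[OF S(1)] S(2) sub] .
    qed (use \<open>0 < \<alpha>\<close> in \<open>auto simp: layer_def\<close>)
    also have "3 ^ CARD('n) / (\<alpha> / (2 * 4 ^ Suc m)) = (3 ^ CARD('n) * (2 * 4 ^ Suc m)) * (1 / \<alpha>)"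
      using \<open>0 < \<alpha>\<close> by simp
    also have "\<dots> powr p = (3 ^ CARD('n) * (2 * 4 ^ Suc m)) powr p * \<alpha> powr - p"
      using \<open>0 < \<alpha>\<close> by (simp only: powr_mult) (simp add: powr_divide powr_minus field_simps)
    finally show ?thesis by (simp only: c_def mult.assoc)
  qed
  have sl: "level_set (2 ^ m) (layer S f \<alpha> m) \<in> sets lebesgue" for m
  proof (rule sets_level_set)
    show "finite (layer S f \<alpha> m)" using S(1) by (auto simp: layer_def)
    show "layer S f \<alpha> m \<subseteq> sets lebesgue" using S(2) sets_cubes by (auto simp: layer_def)
  qed simp
  have sL: "\<Union>(large_cubes S f \<alpha>) \<in> sets lebesgue"
  proof (rule sets.finite_Union)
    show "finite (large_cubes S f \<alpha>)" using S(1) by (auto simp: large_cubes_def)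
    show "large_cubes S f \<alpha> \<subseteq> sets lebesgue" using S(2) sets_cubes by (auto simp: large_cubes_def)
  qed
  have "wmeasure w {x. ennreal \<alpha> < sparse_operator S f x}
      \<le> wmeasure w (\<Union>(large_cubes S f \<alpha>) \<union> (\<Union>m. level_set (2 ^ m) (layer S f \<alpha> m)))"
    by (intro wmeasure_mono sparse_operator_superlevel_subset S \<open>0 < \<alpha>\<close>)
  also have "\<dots> \<le> wmeasure w (\<Union>(large_cubes S f \<alpha>)) + wmeasure w (\<Union>m. level_set (2 ^ m) (layer S f \<alpha> m))"
    using sL sl by (intro wmeasure_Un_le[OF w(1)] sets.countable_UN) auto
  also have "\<dots> \<le> ennreal ((2 / \<alpha>) powr p) * ?I + (\<Sum>m. ennreal (c m * \<alpha> powr - p) * ?I)"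
  proof (rule add_mono)
    have "wmeasure w (\<Union>m. level_set (2 ^ m) (layer S f \<alpha> m))
        \<le> (\<Sum>m. wmeasure w (level_set (2 ^ m) (layer S f \<alpha> m)))"
      by (rule wmeasure_UN_le[OF w(1) sl])
    also have "\<dots> \<le> (\<Sum>m. ennreal (c m * \<alpha> powr - p) * ?I)"
      by (intro suminf_le layer) auto
    finally show "wmeasure w (\<Union>m. level_set (2 ^ m) (layer S f \<alpha> m)) \<le> \<dots>" .
  qed (rule wmeasure_large_cubes_le[OF w S(1,2) \<open>0 < \<alpha>\<close> \<open>0 < p\<close>])
  also have "\<dots> = (ennreal ((2 / \<alpha>) powr p) + (\<Sum>m. ennreal (c m * \<alpha> powr - p))) * ?I"
    by (simp add: distrib_right)
  also have "(\<Sum>m. ennreal (c m * \<alpha> powr - p)) = ennreal ((\<Sum>m. c m) * \<alpha> powr - p)"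
    using c c0 by (subst suminf_ennreal2) (auto simp: summable_mult2 suminf_mult2)
  also have "(2 / \<alpha>) powr p = 2 powr p * \<alpha> powr - p"
    using \<open>0 < \<alpha>\<close> by (simp add: powr_divide powr_minus field_simps)
  also have "ennreal (2 powr p * \<alpha> powr - p) + ennreal ((\<Sum>m. c m) * \<alpha> powr - p)
      = ennreal (2 powr p * \<alpha> powr - p + (\<Sum>m. c m) * \<alpha> powr - p)"
    using suminf_nonneg[OF c c0] by (intro ennreal_plus[symmetric]) auto
  also have "2 powr p * \<alpha> powr - p + (\<Sum>m. c m) * \<alpha> powr - p = K * \<alpha> powr - p"
    by (simp only: K_def c_def distrib_right)
  finally show ?thesis .
qed

text \<open>The operator is the supremum of its finite partial sums. The superlevel sets of an
  exhausting sequence therefore increase and cover that of \<open>S\<close>, and continuity from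
  below transfers the uniform bound \<open>B\<close>.\<close>

lemma wmeasure_superlevel_le:
  fixes w f :: "real^'n \<Rightarrow> real"
  assumes w: "w \<in> borel_measurable lebesgue" and S: "countable S" "S \<subseteq> cubes"
    and fin: "\<And>T. finite T \<Longrightarrow> T \<subseteq> S \<Longrightarrow> wmeasure w {x. ennreal \<alpha> < sparse_operator T f x} \<le> B"
  shows "wmeasure w {x. ennreal \<alpha> < sparse_operator S f x} \<le> B"
proof -
  \<comment> \<open>The intersection matters when \<open>S\<close> is empty, since
    \<open>from_nat_into\<close> then returns an arbitrary value.\<close>
  define T where "T = (\<lambda>k. S \<inter> from_nat_into S ` {..<k})"
  have T: "finite (T k)" "T k \<subseteq> S" for k by (auto simp: T_def)
  have mono: "T j \<subseteq> T k" if "j \<le> k" for j k using that by (auto simp: T_def)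
  have cover: "\<exists>k. F \<subseteq> T k" if "finite F" "F \<subseteq> S" for F
    using that
  proof (induction F rule: finite_induct)
    case (insert Q F)
    then obtain k where k: "F \<subseteq> T k" by auto
    have "Q = from_nat_into S (to_nat_on S Q)"
      using insert.prems S(1) by (simp add: from_nat_into_to_nat_on)
    then have "Q \<in> T (Suc (to_nat_on S Q))" using insert.prems by (auto simp: T_def)
    then have "insert Q F \<subseteq> T (max k (Suc (to_nat_on S Q)))"
      using k mono[of k "max k (Suc (to_nat_on S Q))"]
        mono[of "Suc (to_nat_on S Q)" "max k (Suc (to_nat_on S Q))"] by auto
    then show ?case by blast
  qed simp
  let ?E = "\<lambda>k. {x. ennreal \<alpha> < sparse_operator (T k) f x}"
  have mono_op: "sparse_operator F f x \<le> sparse_operator G f x" if "finite G" "F \<subseteq> G" for F G x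
    using that finite_subset[OF that(2,1)] by (auto simp: sparse_operator_def simp del: sum_mult_indicator intro!: sum_mono2)
  have sE: "?E k \<in> sets lebesgue" for k
    using sets_superlevel_sparse_operator[OF T(1)] T(2)[of k] S(2) by blast
  have inc: "incseq ?E"
    using mono_op[OF T(1) mono] by (auto simp: incseq_def intro: less_le_trans)
  have "{x. ennreal \<alpha> < sparse_operator S f x} \<subseteq> (\<Union>k. ?E k)"
  proof
    fix x assume "x \<in> {x. ennreal \<alpha> < sparse_operator S f x}"
    \<comment> \<open>Strictness is used here: a supremum above \<alpha> is witnessed by one finite
      sum above \<alpha>.\<close>
    then have "ennreal \<alpha> < (SUP F\<in>{F. finite F \<and> F \<subseteq> S}.
        \<Sum>Q\<in>F. avg Q (\<lambda>y. ennreal \<bar>f y\<bar>) * indicator Q x)"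
      by (simp add: sparse_operator_def nonneg_infsum_complete)
    then obtain F where F: "finite F" "F \<subseteq> S" "ennreal \<alpha> < sparse_operator F f x"
      by (auto simp: less_SUP_iff sparse_operator_def)
    then obtain k where "F \<subseteq> T k" using cover by metis
    then have "ennreal \<alpha> < sparse_operator (T k) f x"
      using F(3) mono_op[OF T(1)] by (metis less_le_trans)
    then show "x \<in> (\<Union>k. ?E k)" by blast
  qed
  then have "wmeasure w {x. ennreal \<alpha> < sparse_operator S f x} \<le> wmeasure w (\<Union>k. ?E k)"
    by (rule wmeasure_mono)
  also have "\<dots> = emeasure (density lebesgue (\<lambda>x. ennreal (w x))) (\<Union>k. ?E k)"
    by (rule wmeasure_eq_emeasure[OF w sets.countable_UN]) (use sE in auto)
  also have "\<dots> = (SUP k. emeasure (density lebesgue (\<lambda>x. ennreal (w x))) (?E k))"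
    by (rule SUP_emeasure_incseq[symmetric]) (use sE inc in auto)
  also have "\<dots> = (SUP k. wmeasure w (?E k))"
    using sE by (simp only: wmeasure_eq_emeasure[OF w])
  also have "\<dots> \<le> B" by (intro SUP_least fin T)
  finally show ?thesis .
qed

theorem theorem1p4:
  fixes D S :: "(real^'n) set set" and w :: "real^'n \<Rightarrow> real" and \<eta> p :: real
  assumes "dyadic_lattice D" and "S \<subseteq> D"
    and "0 < \<eta>" and "\<eta> < 1" and "sparse_family \<eta> S"
    and "0 < p" and "weight w" and "SC p w"
  shows "\<exists>C::real. 0 < C \<and> (\<forall>f. locally_integrable f \<longrightarrow>
           weak_Lp_norm p w (sparse_operator S f) \<le> ennreal C * Lp_norm p w (HL_maximal f))"
proof -
  have S: "countable S" "S \<subseteq> cubes" "laminar S"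
    using countable_subset[OF assms(2) countable_dyadic_lattice[OF assms(1)]]
      dyadic_lattice_cubes[OF assms(1)] assms(2) laminar_subset[OF laminar_dyadic_lattice[OF assms(1)] assms(2)]
    by auto
  have w: "w \<in> borel_measurable lebesgue" "\<And>x. 0 \<le> w x"
    using assms(7) borel_measurable_locally_integrable by (auto simp: weight_def)
  obtain C r where C: "0 < C" and r: "1 < r"
    and SC: "\<And>F. F \<subseteq> cubes \<Longrightarrow> disjoint F \<Longrightarrow>
        (\<Sum>\<^sub>\<infinity>Q\<in>F. ennpow (avg Q (\<lambda>x. ennreal (w x powr r))) (1 / r) * emeasure lebesgue Q)
          \<le> ennreal C * (\<integral>\<^sup>+x. ennpow (HL_maximal (indicator (\<Union>F)) x) p * ennreal (w x) \<partial>lebesgue)"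
    using assms(8) unfolding SC_def by blast
  \<comment> \<open>The maximum with 1 secures \<open>0 < K\<close> without any discussion of the
    series.\<close>
  define K where "K = max 1 (2 powr p + (\<Sum>m. 2 * C * ((1 - \<eta>) powr (1 - 1 / r)) ^ 2 ^ m
    * (3 ^ CARD('n) * (2 * 4 ^ Suc m)) powr p))"
  have K: "0 < K" by (simp add: K_def)
  have "weak_Lp_norm p w (sparse_operator S f) \<le> ennreal (K powr (1 / p)) * Lp_norm p w (HL_maximal f)"
    if "locally_integrable f" for f
    unfolding weak_Lp_norm_def
  proof (rule SUP_least)
    fix \<alpha> :: real assume "\<alpha> \<in> {0<..}"
    then have \<alpha>: "0 < \<alpha>" by simp
    let ?I = "\<integral>\<^sup>+x. ennpow (HL_maximal f x) p * ennreal (w x) \<partial>lebesgue"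
    have f: "f \<in> borel_measurable lebesgue" using borel_measurable_locally_integrable[OF that] .
    have "wmeasure w {x. ennreal \<alpha> < sparse_operator S f x} \<le> ennreal (K * \<alpha> powr - p) * ?I"
    proof (rule wmeasure_superlevel_le[OF w(1) S(1,2)])
      fix T assume T: "finite T" "T \<subseteq> S"
      have "wmeasure w {x. ennreal \<alpha> < sparse_operator T f x}
          \<le> ennreal ((2 powr p + (\<Sum>m. 2 * C * ((1 - \<eta>) powr (1 - 1 / r)) ^ 2 ^ m
            * (3 ^ CARD('n) * (2 * 4 ^ Suc m)) powr p)) * \<alpha> powr - p) * ?I"
        using T(2) S(2) laminar_subset[OF S(3) T(2)] sparse_family_subset[OF assms(5) S(1,2) T(2)]
        by (intro wmeasure_superlevel_finite_le[OF w f T(1) _ _ _ assms(3,4,6) C r \<alpha> SC]) auto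
      also have "\<dots> \<le> ennreal (K * \<alpha> powr - p) * ?I"
        unfolding K_def by (intro mult_right_mono ennreal_leI max.cobounded2) auto
      finally show "wmeasure w {x. ennreal \<alpha> < sparse_operator T f x} \<le> ennreal (K * \<alpha> powr - p) * ?I" .
    qed
    \<comment> \<open>The power \<open>1 / p\<close> turns \<open>K * \<alpha> powr - p\<close> into
      \<open>K powr (1 / p) / \<alpha>\<close>, so the factor \<alpha> of the weak norm cancels and
      the constant is uniform in \<alpha>.\<close>
    then have "ennpow (wmeasure w {x. ennreal \<alpha> < sparse_operator S f x}) (1 / p)
        \<le> ennpow (ennreal (K * \<alpha> powr - p) * ?I) (1 / p)"
      using assms(6) by (intro ennpow_mono) auto
    also have "\<dots> = ennreal ((K * \<alpha> powr - p) powr (1 / p)) * Lp_norm p w (HL_maximal f)"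
      using K \<alpha> by (simp add: ennpow_cmult Lp_norm_def)
    also have "(K * \<alpha> powr - p) powr (1 / p) = K powr (1 / p) / \<alpha>"
    proof -
      have "(\<alpha> powr - p) powr (1 / p) = 1 / \<alpha>"
        using \<alpha> assms(6) by (simp only: powr_powr) (simp add: powr_minus_divide)
      then show ?thesis using K by (simp add: powr_mult)
    qed
    finally have "ennreal \<alpha> * ennpow (wmeasure w {x. ennreal \<alpha> < sparse_operator S f x}) (1 / p)
        \<le> ennreal \<alpha> * (ennreal (K powr (1 / p) / \<alpha>) * Lp_norm p w (HL_maximal f))"
      by (rule mult_left_mono) simp
    also have "\<dots> = ennreal (K powr (1 / p)) * Lp_norm p w (HL_maximal f)"
      using \<alpha> by (simp add: mult.assoc[symmetric] ennreal_mult[symmetric])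
    finally show "ennreal \<alpha> * ennpow (wmeasure w {x. sparse_operator S f x > ennreal \<alpha>}) (1 / p)
        \<le> ennreal (K powr (1 / p)) * Lp_norm p w (HL_maximal f)" .
  qed
  then show ?thesis using K by (intro exI[of _ "K powr (1 / p)"]) auto
qed

end
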